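(* Let $\alpha>0$, let $\nu$ be a probability measure on $\mathbb{R}_+=[0,\infty)$, and let $\{X_n : n\in\mathbb{N}_0\}$ be a Kendall random walk with parameter $\alpha$ and unit step distribution $\nu$. Let $G$ and $H$ be the functions $$G(t)=\int_0^\infty \Psi\left(\frac{x}{t}\right)\nu(dx),\qquad H(t)=\int_{[0,t]} y^\alpha\,\nu(dy),\qquad t>0,\qquad \Psi(u)=(1-u^\alpha)_+ .$$ Then for any $k\in\mathbb{N}$, any $0=:n_0\le n_1\le n_2\le\cdots\le n_k$ with $n_j\in\mathbb{N}$ for $1\le j\le k$, and any $0< x_1\le x_2\le\cdots\le x_k$, $$\mathbb{P}(X_{n_k}\le x_k, X_{n_{k-1}}\le x_{k-1},\dots,X_{n_1}\le x_1)=\sum_{(\epsilon_1,\dots,\epsilon_k)\in\{0,1\}^k}\ \prod_{i=1}^{s-1}\Psi\left(\frac{x_{\tilde\epsilon_i}}{x_{\tilde\epsilon_{i+1}}}\right)\prod_{j=1}^k (G(x_j))^{n_j-n_{j-1}-\epsilon_j}\left(\frac{(n_j-n_{j-1})H(x_j)}{x_j^\alpha}\right)^{\epsilon_j},$$ where, for each $(\epsilon_1,\dots,\epsilon_k)$, $s=\sum_{i=1}^k\epsilon_i$ and $\tilde\epsilon_1<\tilde\epsilon_2<\cdots<\tilde\epsilon_s$ are the indices $i\in\{1,\dots,k\}$ with $\epsilon_i=1$, listed in increasing order, and $\prod_{i=1}^{s-1}\Psi(x_{\tilde\epsilon_i}/x_{\tilde\epsilon_{i+1}})=1$ for $s\i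n\{0,1\}$.
   Context: $\mathbb{N}=\{1,2,\dots\}$, $\mathbb{N}_0=\mathbb{N}\cup\{0\}$, $a_+=\max(0,a)$. Kendall random walk with parameter $\alpha>0$ and step distribution $\nu$: let $\{Y_k\}$ be i.i.d. with distribution $\nu$, $\{\xi_k\}$ i.i.d. uniform on $[0,1]$, and $\{\theta_k\}$ i.i.d. with the Pareto density $2\alpha y^{-2\alpha-1}\mathbf{1}_{[1,\infty)}(y)$, the three sequences being independent of each other. Set $X_0=1$, $X_1=Y_1$ and, for $n\ge1$, $$X_{n+1}=M_{n+1}\left[\mathbf{1}_{(\xi_n>\varrho_{n+1})}+\theta_{n+1}\mathbf{1}_{(\xi_n<\varrho_{n+1})}\right],$$ where $M_{n+1}=\max\{X_n,Y_{n+1}\}$, $m_{n+1}=\min\{X_n,Y_{n+1}\}$, $\varrho_{n+1}=m_{n+1}^\alpha/M_{n+1}^\alpha$ (when $M_{n+1}=0$, $X_{n+1}=0$). Conventions: $0^0=1$; a summand in which $\epsilon_j=1$ and $n_j=n_{j-1}$ for some $j$ is equal to $0$. *)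

theory Defs
  imports "HOL-Probability.Probability"
begin

text \<open>
  All sequences of the walk are indexed by the positive integers, i.e. by \<^term>\<open>{1::nat..}\<close>.
  The measure \<open>\<nu>\<close> on the half-line is represented as a Borel measure on the real line
  giving full mass to \<^term>\<open>{0::real..}\<close>.

  The three assumptions \<open>indep_Y\<close>, \<open>indep_\<xi>\<close>, \<open>indep_\<theta>\<close> give independence inside each sequence;
  \<open>indep_seqs\<close> gives independence of the three sequences from each other, each of them
  being regarded as a random element of the product space.

  If the maximum \<open>Mx\<close> vanishes, then the quotient \<open>\<rho>\<close> is \<open>0 / 0 = 0\<close>, and the
  product with \<open>Mx\<close> makes the next position \<open>0\<close>.
\<close>

locale kendall_random_walk = prob_space M
  for M :: "'a measure" +
  fixes \<alpha> :: real
    and \<nu> :: "real measure"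
    and Y \<xi> \<theta> X :: "nat \<Rightarrow> 'a \<Rightarrow> real"
  assumes \<alpha>_pos: "\<alpha> > 0"
    and prob_space_\<nu>: "prob_space \<nu>"
    and sets_\<nu>: "sets \<nu> = sets borel"
    and \<nu>_nonneg: "measure \<nu> {0..} = 1"
    and random_variable_Y: "\<And>k. k \<ge> 1 \<Longrightarrow> random_variable borel (Y k)"
    and distr_Y: "\<And>k. k \<ge> 1 \<Longrightarrow> distr M borel (Y k) = \<nu>"
    and distributed_\<xi>: "\<And>k. k \<ge> 1 \<Longrightarrow> distributed M lborel (\<xi> k) (indicator {0..1})"
    and distributed_\<theta>: "\<And>k. k \<ge> 1 \<Longrightarrow>
          distributed M lborel (\<theta> k)
            (\<lambda>y. ennreal (2 * \<alpha> * y powr (- 2 * \<alpha> - 1) * indicator {1..} y))"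
    and indep_Y: "indep_vars (\<lambda>_. borel) Y {1..}"
    and indep_\<xi>: "indep_vars (\<lambda>_. borel) \<xi> {1..}"
    and indep_\<theta>: "indep_vars (\<lambda>_. borel) \<theta> {1..}"
    and indep_seqs: "indep_vars (\<lambda>_. \<Pi>\<^sub>M k\<in>{1..}. borel)
          (\<lambda>i \<omega>. \<lambda>k\<in>{1..}. ([Y, \<xi>, \<theta>] ! i) k \<omega>) {0, 1, 2}"
    and X_0: "\<And>\<omega>. \<omega> \<in> space M \<Longrightarrow> X 0 \<omega> = 1"
    and X_1: "\<And>\<omega>. \<omega> \<in> space M \<Longrightarrow> X 1 \<omega> = Y 1 \<omega>"
    and X_step: "\<And>n \<omega>. n \<ge> 1 \<Longrightarrow> \<omega> \<in> space M \<Longrightarrow>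
          X (n + 1) \<omega> =
            (let Mx = max (X n \<omega>) (Y (n + 1) \<omega>);
                 mn = min (X n \<omega>) (Y (n + 1) \<omega>);
                 \<rho> = mn powr \<alpha> / Mx powr \<alpha>
             in Mx * (of_bool (\<xi> n \<omega> > \<rho>) + \<theta> (n + 1) \<omega> * of_bool (\<xi> n \<omega> < \<rho>)))"

definition kendall_Psi :: "real \<Rightarrow> real \<Rightarrow> real" where
  "kendall_Psi \<alpha> u = max 0 (1 - u powr \<alpha>)"

definition kendall_G :: "real \<Rightarrow> real measure \<Rightarrow> real \<Rightarrow> real" where
  "kendall_G \<alpha> \<nu> t = (LINT x:{0..}|\<nu>. kendall_Psi \<alpha> (x / t))"

definition kendall_H :: "real \<Rightarrow> real measure \<Rightarrow> real \<Rightarrow> real" where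
  "kendall_H \<alpha> \<nu> t = (LINT y:{0..t}|\<nu>. y powr \<alpha>)"

text \<open>
  \<open>one_index k \<epsilon> i\<close> is the \<open>i\<close>-th smallest index (counting from 1) in \<open>{1..k}\<close>
  at which \<open>\<epsilon>\<close> takes the value 1; it is meaningful for \<open>1 \<le> i \<le> (\<Sum>j=1..k. \<epsilon> j)\<close>.
\<close>

definition one_index :: "nat \<Rightarrow> (nat \<Rightarrow> nat) \<Rightarrow> nat \<Rightarrow> nat" where
  "one_index k \<epsilon> i = sorted_list_of_set {j \<in> {1..k}. \<epsilon> j = 1} ! (i - 1)"

text \<open>
  The summand belonging to \<open>\<epsilon>\<close>. By convention it is 0 if \<open>\<epsilon> j = 1\<close> and \<open>n j = n (j - 1)\<close>
  for some \<open>j\<close>; for nondecreasing \<open>n\<close>, in the remaining case the exponent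
  \<open>n j - n (j - 1) - \<epsilon> j\<close> is nonnegative, so that subtraction on the natural numbers
  does not truncate.
\<close>

definition kendall_summand ::
  "real \<Rightarrow> real measure \<Rightarrow> nat \<Rightarrow> (nat \<Rightarrow> nat) \<Rightarrow> (nat \<Rightarrow> real) \<Rightarrow> (nat \<Rightarrow> nat) \<Rightarrow> real" where
  "kendall_summand \<alpha> \<nu> k n x \<epsilon> =
     (if \<exists>j\<in>{1..k}. \<epsilon> j = 1 \<and> n j = n (j - 1) then 0
      else
        (let s = (\<Sum>i=1..k. \<epsilon> i)
         in \<Prod>i\<in>{1..<s}. kendall_Psi \<alpha> (x (one_index k \<epsilon> i) / x (one_index k \<epsilon> (i + 1)))) *
        (\<Prod>j=1..k. kendall_G \<alpha> \<nu> (x j) ^ (n j - n (j - 1) - \<epsilon> j) *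
           (real (n j - n (j - 1)) * kendall_H \<alpha> \<nu> (x j) / x j powr \<alpha>) ^ \<epsilon> j))"

end

theory Submission
  imports Defs
begin

text \<open>
  For a level \<open>x > 0\<close> consider the functions
  \<open>q\<^sub>c(u) = (1 - c u\<^sup>\<alpha>) \<one>[0 \<le> u \<le> x]\<close>, where \<open>c\<close> is a real number; here they are
  called \<open>kendall_test \<alpha> x c\<close>. The case \<open>c = 0\<close> is the indicator of \<open>[0, x]\<close>, and
  \<open>c = x powr (- \<alpha>)\<close> gives \<open>\<Psi>(u / x)\<close>. The Pareto law with exponent \<open>2 \<alpha>\<close> has the effect
  that the transition operator \<open>K\<close> of the walk maps this two-dimensional space of functions
  to itself and acts there by a triangular matrix:
  \<open>K q\<^sub>c = G(x) q\<^sub>c + (H(x) / x\<^sup>\<alpha>) (1 - c x\<^sup>\<alpha>) \<Psi>(\<cdot> / x)\<close> (lemma \<open>integral_transition\<close>).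
  In particular \<open>\<Psi>(\<cdot> / x)\<close> is an eigenfunction with eigenvalue \<open>G(x)\<close>, so that \<open>m\<close> steps give
  \<open>K\<^sup>m q\<^sub>c = G(x)\<^sup>m q\<^sub>c + m G(x)\<^sup>m\<^sup>-\<^sup>1 (H(x) / x\<^sup>\<alpha>) (1 - c x\<^sup>\<alpha>) \<Psi>(\<cdot> / x)\<close>
  (lemma \<open>expectation_steps\<close>). These are the two alternatives \<open>\<epsilon>\<^sub>j = 0\<close> and \<open>\<epsilon>\<^sub>j = 1\<close>
  of one block of steps.

  The theorem follows by induction on the number of blocks from a slightly stronger statement
  (lemma \<open>expectation_barriers\<close>): with \<open>A\<^sub>k\<close> the event that the first \<open>k\<close> barriers are respected,
  \<open>E[\<one>(A\<^sub>k) (1 - c X(n\<^sub>k)\<^sup>\<alpha>)]\<close> is the sum of the summands of the theorem, each multiplied by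
  \<open>1 - c z\<^sup>\<alpha>\<close>, where \<open>z\<close> is the barrier at the last index with \<open>\<epsilon>\<^sub>j = 1\<close>, and \<open>z = 0\<close> if there is
  none. In the next block, the choice \<open>\<epsilon>\<^sub>k\<^sub>+\<^sub>1 = 0\<close> keeps the factor \<open>1 - c z\<^sup>\<alpha>\<close>, while
  \<open>\<epsilon>\<^sub>k\<^sub>+\<^sub>1 = 1\<close> replaces it by \<open>1 - c x\<^sup>\<alpha>\<close> with the new barrier \<open>x\<close>, and the expectation of
  \<open>\<one>(A\<^sub>k) \<Psi>(X(n\<^sub>k) / x)\<close> that comes with it turns the old factor into \<open>1 - z\<^sup>\<alpha> / x\<^sup>\<alpha> = \<Psi>(z / x)\<close>.
  The theorem is the case \<open>c = 0\<close>. Monotonicity of the barriers enters because on \<open>A\<^sub>k\<close> the walk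
  is below the next barrier at time \<open>n\<^sub>k\<close>, so that there the truncation of \<open>q\<^sub>c\<close> is invisible.

  The passage from the operator \<open>K\<close> to expectations is the Markov property in the form of lemma
  \<open>expectation_step\<close>. It rests on the fact that the variables driving a step are independent of
  the history, which in turn needs the joint independence of all the variables in the three
  sequences (lemma \<open>indep_vars_Times\<close>).
\<close>

section \<open>The transition kernel on powers truncated at a level\<close>

definition kendall_test :: "real \<Rightarrow> real \<Rightarrow> real \<Rightarrow> real \<Rightarrow> real" where
  "kendall_test \<alpha> x c u = indicator {0..x} u * (1 - c * u powr \<alpha>)"

definition kendall_step :: "real \<Rightarrow> real \<Rightarrow> real \<Rightarrow> real \<Rightarrow> real \<Rightarrow> real" where
  "kendall_step \<alpha> u y s t =
     (let Mx = max u y; mn = min u y; \<rho> = mn powr \<alpha> / Mx powr \<alpha>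
      in Mx * (of_bool (s > \<rho>) + t * of_bool (s < \<rho>)))"

abbreviation unit_uniform :: "real measure" where
  "unit_uniform \<equiv> density lborel (indicator {0..1})"

definition pareto :: "real \<Rightarrow> real measure" where
  "pareto \<alpha> = density lborel (\<lambda>y. ennreal (2 * \<alpha> * y powr (- 2 * \<alpha> - 1) * indicator {1..} y))"

lemma sets_pareto [simp, measurable_cong]: "sets (pareto \<alpha>) = sets borel"
  by (simp add: pareto_def)

lemma space_pareto [simp]: "space (pareto \<alpha>) = UNIV"
  by (simp add: pareto_def)

lemma measurable_kendall_test [measurable]: "kendall_test \<alpha> x c \<in> borel_measurable borel"
  unfolding kendall_test_def by measurable

lemma measurable_kendall_step [measurable (raw)]:
  assumes [measurable]: "f \<in> borel_measurable N" "g \<in> borel_measurable N"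
    "h \<in> borel_measurable N" "k \<in> borel_measurable N"
  shows "(\<lambda>w. kendall_step \<alpha> (f w) (g w) (h w) (k w)) \<in> borel_measurable N"
  unfolding kendall_step_def Let_def by measurable

lemma kendall_test_bounded:
  assumes "\<alpha> > 0"
  shows "\<bar>kendall_test \<alpha> x c u\<bar> \<le> 1 + \<bar>c\<bar> * x powr \<alpha>"
proof (cases "u \<in> {0..x}")
  case True
  then have "u powr \<alpha> \<le> x powr \<alpha>" using assms by (intro powr_mono2) auto
  then have "\<bar>c * u powr \<alpha>\<bar> \<le> \<bar>c\<bar> * x powr \<alpha>"
    by (simp add: abs_mult mult_left_mono)
  then show ?thesis using True by (simp add: kendall_test_def)
qed (simp add: kendall_test_def)

lemma prob_space_pareto:
  assumes "\<alpha> > 0" shows "prob_space (pareto \<alpha>)"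
proof
  have "((\<lambda>x. - (x powr (- 2 * \<alpha>))) \<longlongrightarrow> 0) at_top"
    using assms by real_asymp
  then have "(\<integral>\<^sup>+x. ennreal (2 * \<alpha> * x powr (- 2 * \<alpha> - 1)) * indicator {1..} x \<partial>lborel)
    = ennreal (0 - (- (1 powr (- 2 * \<alpha>))))"
    using assms
    by (intro nn_integral_FTC_atLeast) (auto intro!: derivative_eq_intros simp: field_simps)
  also have "(\<integral>\<^sup>+x. ennreal (2 * \<alpha> * x powr (- 2 * \<alpha> - 1)) * indicator {1..} x \<partial>lborel)
    = (\<integral>\<^sup>+x. ennreal (2 * \<alpha> * x powr (- 2 * \<alpha> - 1) * indicator {1..} x) \<partial>lborel)"
    by (intro nn_integral_cong) (auto simp: indicator_def)
  finally show "emeasure (pareto \<alpha>) (space (pareto \<alpha>)) = 1"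
    by (simp add: pareto_def emeasure_density)
qed

lemma AE_pareto_ge_1: "AE t in pareto \<alpha>. t \<ge> 1"
  unfolding pareto_def by (subst AE_density) (auto simp: indicator_def split: if_splits)

text \<open>
  The value of the test function after a jump from \<open>a\<close> by a Pareto factor. The integrand
  vanishes beyond \<open>t = x / a\<close>, and on \<open>[1, x / a]\<close> it has the antiderivative
  \<open>- t powr (- 2 \<alpha>) + 2 c a\<^sup>\<alpha> t powr (- \<alpha>)\<close>.
\<close>

lemma integral_pareto_test:
  assumes "\<alpha> > 0" "0 < a" "a \<le> x"
  shows "(LINT t|pareto \<alpha>. kendall_test \<alpha> x c (a * t)) =
    1 - (a powr \<alpha>)\<^sup>2 / (x powr \<alpha>)\<^sup>2 - 2 * c * a powr \<alpha> * (1 - a powr \<alpha> / x powr \<alpha>)"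
proof -
  define f where "f t = 2 * \<alpha> * t powr (- 2 * \<alpha> - 1) * (1 - c * a powr \<alpha> * t powr \<alpha>)" for t
  define F where "F t = - (t powr (- 2 * \<alpha>)) + 2 * c * a powr \<alpha> * t powr (- \<alpha>)" for t
  have "(LINT t|pareto \<alpha>. kendall_test \<alpha> x c (a * t)) =
      (LINT t|lborel. (2 * \<alpha> * t powr (- 2 * \<alpha> - 1) * indicator {1..} t) *\<^sub>R kendall_test \<alpha> x c (a * t))"
    unfolding pareto_def using assms by (intro integral_density) auto
  also have "\<dots> = (LINT t|lborel. f t * indicator {1..x/a} t)"
    using assms
    by (intro Bochner_Integration.integral_cong)
       (auto simp: f_def kendall_test_def indicator_def powr_mult field_simps split: if_splits)
  also have "\<dots> = F (x / a) - F 1"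
  proof (rule integral_FTC_Icc_real)
    show "1 \<le> x / a" using assms by simp
  next
    fix t :: real assume "1 \<le> t" "t \<le> x / a"
    then have t: "t > 0" by simp
    have "t powr (- 2 * \<alpha> - 1) * t powr \<alpha> = t powr (- \<alpha> - 1)"
      using t by (simp add: powr_add [symmetric])
    then have "f t = 2 * \<alpha> * t powr (- 2 * \<alpha> - 1) - 2 * \<alpha> * c * a powr \<alpha> * t powr (- \<alpha> - 1)"
      by (simp add: f_def algebra_simps)
    then show "(F has_real_derivative f t) (at t)"
      unfolding F_def using t by (auto intro!: derivative_eq_intros)
    show "isCont f t" unfolding f_def using t by (intro continuous_intros) auto
  qed
  also have "(x / a) powr (- 2 * \<alpha>) = (a powr \<alpha>)\<^sup>2 / (x powr \<alpha>)\<^sup>2"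
    using assms by (simp add: powr_divide powr_minus power2_eq_square powr_add [symmetric] field_simps)
  then have "F (x / a) - F 1 =
     1 - (a powr \<alpha>)\<^sup>2 / (x powr \<alpha>)\<^sup>2 - 2 * c * a powr \<alpha> * (1 - a powr \<alpha> / x powr \<alpha>)"
    using assms by (simp add: F_def powr_divide powr_minus field_simps)
  finally show ?thesis .
qed

lemma prob_space_unit_uniform: "prob_space unit_uniform"
  by standard (simp add: emeasure_density)

lemma measure_unit_uniform_greater:
  assumes "0 \<le> r" "r \<le> 1" shows "measure unit_uniform {r<..} = 1 - r"
proof -
  have "emeasure unit_uniform {r<..} = emeasure lborel ({0..1} \<inter> {r<..})"
    by (simp add: emeasure_density indicator_inter_arith [symmetric])
  also have "{0..1} \<inter> {r<..} = {r<..1}" using assms by auto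
  finally show ?thesis using assms by (simp add: measure_def)
qed

lemma measure_unit_uniform_less:
  assumes "0 \<le> r" "r \<le> 1" shows "measure unit_uniform {..<r} = r"
proof -
  have "emeasure unit_uniform {..<r} = emeasure lborel ({0..1} \<inter> {..<r})"
    by (simp add: emeasure_density indicator_inter_arith [symmetric])
  also have "{0..1} \<inter> {..<r} = {0..<r}" using assms by auto
  finally show ?thesis using assms by (simp add: measure_def)
qed

lemma AE_unit_uniform_neq: "AE s in unit_uniform. s \<noteq> r"
  using AE_lborel_singleton[of r] by (subst AE_density) auto

text \<open>
  Averaging over \<open>\<xi>\<close> and \<open>\<theta>\<close>. Let \<open>a\<close> be the larger and \<open>b\<close> the smaller one of \<open>u\<close> and \<open>y\<close>.
  The walk stays at \<open>a\<close> with probability \<open>1 - \<rho>\<close> and jumps with probability \<open>\<rho>\<close>. Since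
  \<open>\<rho> a\<^sup>\<alpha> = b\<^sup>\<alpha>\<close>, all terms with the square of \<open>a\<^sup>\<alpha>\<close> turn into products \<open>a\<^sup>\<alpha> b\<^sup>\<alpha>\<close>, so that the
  result is symmetric in \<open>u\<close> and \<open>y\<close> and affine in each of \<open>u\<^sup>\<alpha>\<close> and \<open>y\<^sup>\<alpha>\<close>. This bilinearity is
  the reason why the integral over \<open>y\<close> involves only the total mass and \<open>H\<close>.
\<close>

lemma integral_kendall_step:
  assumes "\<alpha> > 0" "0 \<le> u" "0 \<le> y" "0 < x"
  shows "(LINT s|unit_uniform. LINT t|pareto \<alpha>. kendall_test \<alpha> x c (kendall_step \<alpha> u y s t)) =
    (if u \<le> x \<and> y \<le> x
     then 1 - c * (u powr \<alpha> + y powr \<alpha>) - u powr \<alpha> * y powr \<alpha> / (x powr \<alpha>)\<^sup>2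
            + 2 * c * u powr \<alpha> * y powr \<alpha> / x powr \<alpha>
     else 0)" (is "?I = ?R")
proof -
  interpret P: prob_space "pareto \<alpha>" by (rule prob_space_pareto) fact
  interpret U: prob_space unit_uniform by (rule prob_space_unit_uniform)
  define a where "a = max u y"
  define \<rho> where "\<rho> = min u y powr \<alpha> / a powr \<alpha>"
  \<comment> \<open>The mean value after a jump; for \<open>a = 0\<close> it comes with the weight \<open>\<rho> = 0\<close>.\<close>
  define J where "J = (LINT t|pareto \<alpha>. kendall_test \<alpha> x c (a * t))"
  have \<rho>: "0 \<le> \<rho>" "\<rho> \<le> 1"
    using assms by (auto simp: \<rho>_def a_def divide_le_eq_1 intro!: powr_mono2)
  have prod: "\<rho> * a powr \<alpha> = min u y powr \<alpha>"
    using assms by (cases "a = 0") (auto simp: \<rho>_def a_def)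
  have "?I = (LINT s|unit_uniform. indicator {\<rho><..} s * kendall_test \<alpha> x c a + indicator {..<\<rho>} s * J)"
  proof (rule integral_cong_AE)
    show "AE s in unit_uniform.
      (LINT t|pareto \<alpha>. kendall_test \<alpha> x c (kendall_step \<alpha> u y s t)) =
      indicator {\<rho><..} s * kendall_test \<alpha> x c a + indicator {..<\<rho>} s * J"
      using AE_unit_uniform_neq[of \<rho>]
    proof eventually_elim
      case (elim s)
      then consider "s < \<rho>" | "s > \<rho>" by linarith
      then show ?case
        by cases (simp_all add: kendall_step_def a_def [symmetric] \<rho>_def [symmetric] Let_def J_def P.prob_space [simplified])
    qed
  qed measurable
  also have "\<dots> = (1 - \<rho>) * kendall_test \<alpha> x c a + \<rho> * J"
    using \<rho> by (subst Bochner_Integration.integral_add)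
      (auto simp: measure_unit_uniform_greater measure_unit_uniform_less U.emeasure_eq_measure)
  also have "\<dots> = ?R"
  proof (cases "a \<le> x")
    case True
    have uy: "a powr \<alpha> * min u y powr \<alpha> = u powr \<alpha> * y powr \<alpha>"
      "a powr \<alpha> + min u y powr \<alpha> = u powr \<alpha> + y powr \<alpha>"
      by (auto simp: a_def max_def min_def)
    have T: "kendall_test \<alpha> x c a = 1 - c * a powr \<alpha>"
      using True assms by (auto simp: kendall_test_def a_def)
    have R: "?R = 1 - c * (a powr \<alpha> + min u y powr \<alpha>) - a powr \<alpha> * min u y powr \<alpha> / (x powr \<alpha>)\<^sup>2
            + 2 * c * (a powr \<alpha> * min u y powr \<alpha>) / x powr \<alpha>"
      unfolding uy using True by (simp add: a_def)
    show ?thesis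
    proof (cases "a = 0")
      case True
      then have "\<rho> = 0" "min u y powr \<alpha> = 0" using prod by (auto simp: \<rho>_def)
      then show ?thesis unfolding R T using True by simp
    next
      case False
      then have "a > 0" using assms by (simp add: a_def)
      then have J: "J = 1 - (a powr \<alpha>)\<^sup>2 / (x powr \<alpha>)\<^sup>2 - 2 * c * a powr \<alpha> * (1 - a powr \<alpha> / x powr \<alpha>)"
        unfolding J_def using True assms by (intro integral_pareto_test) auto
      show ?thesis unfolding R T prod [symmetric] J
        by (simp add: field_simps power2_eq_square)
    qed
  next
    case False
    have "J = (LINT t|pareto \<alpha>. 0)"
      unfolding J_def
    proof (rule integral_cong_AE)
      show "AE t in pareto \<alpha>. kendall_test \<alpha> x c (a * t) = 0"
        using AE_pareto_ge_1
      proof eventually_elim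
        case (elim t)
        then have "a * t \<ge> a * 1" using False assms by (intro mult_left_mono) auto
        then show ?case using False by (simp add: kendall_test_def)
      qed
    qed measurable
    then show ?thesis using False by (auto simp: kendall_test_def a_def max_def split: if_splits)
  qed
  finally show ?thesis .
qed

section \<open>Binary sequences and the summands\<close>

text \<open>
  The value 0 in the absence of ones makes \<open>\<Psi>(last_one k \<epsilon> x / x (k + 1)) = 1\<close>, which is the
  empty product of the theorem; it is also the position from which the walk starts.
\<close>

definition last_one :: "nat \<Rightarrow> (nat \<Rightarrow> nat) \<Rightarrow> (nat \<Rightarrow> real) \<Rightarrow> real" where
  "last_one k \<epsilon> x = (if (\<Sum>i=1..k. \<epsilon> i) = 0 then 0 else x (one_index k \<epsilon> (\<Sum>i=1..k. \<epsilon> i)))"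

lemma binary_cases:
  assumes "\<epsilon> \<in> {1..k} \<rightarrow>\<^sub>E {0, 1::nat}" "j \<in> {1..k}"
  shows "\<epsilon> j = 0 \<or> \<epsilon> j = 1"
  using PiE_mem[OF assms] by simp

lemma length_ones:
  assumes "\<epsilon> \<in> {1..k::nat} \<rightarrow>\<^sub>E {0, 1::nat}"
  shows "length (sorted_list_of_set {j \<in> {1..k}. \<epsilon> j = 1}) = (\<Sum>i=1..k. \<epsilon> i)"
proof -
  have "(\<Sum>i=1..k. \<epsilon> i) = (\<Sum>i=1..k. if \<epsilon> i = 1 then 1 else 0)"
    by (intro sum.cong refl) (use binary_cases[OF assms] in auto)
  also have "\<dots> = (\<Sum>i\<in>{j \<in> {1..k}. \<epsilon> j = 1}. 1)"
    by (rule sum.inter_filter [symmetric]) simp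
  finally show ?thesis
    by (simp only: sorted_list_of_set.length_sorted_key_list_of_set card_eq_sum)
qed

lemma sorted_ones_Suc:
  fixes \<epsilon> :: "nat \<Rightarrow> nat"
  shows "sorted_list_of_set {j \<in> {1..Suc k}. (\<epsilon>(Suc k := e)) j = 1} =
     sorted_list_of_set {j \<in> {1..k}. \<epsilon> j = 1} @ (if e = 1 then [Suc k] else [])"
proof -
  have *: "{j \<in> {1..Suc k}. (\<epsilon>(Suc k := e)) j = 1} =
      (if e = 1 then insert (Suc k) {j \<in> {1..k}. \<epsilon> j = 1} else {j \<in> {1..k}. \<epsilon> j = 1})"
    by (auto simp: le_Suc_eq)
  show ?thesis
  proof (cases "e = 1")
    case True
    have "sorted_list_of_set (insert (Suc k) {j \<in> {1..k}. \<epsilon> j = 1}) =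
      insort (Suc k) (sorted_list_of_set {j \<in> {1..k}. \<epsilon> j = 1})"
      by (rule sorted_list_of_set_insert) auto
    also have "\<dots> = sorted_list_of_set {j \<in> {1..k}. \<epsilon> j = 1} @ [Suc k]"
      by (rule sorted_insort_is_snoc) auto
    finally show ?thesis unfolding * using True by (simp only: if_True refl)
  qed (simp only: * if_False append_Nil2)
qed

lemma one_index_update:
  assumes "\<epsilon> \<in> {1..k} \<rightarrow>\<^sub>E {0, 1::nat}" "i \<in> {1..(\<Sum>j=1..k. \<epsilon> j)}"
  shows "one_index (Suc k) (\<epsilon>(Suc k := e)) i = one_index k \<epsilon> i"
  using assms length_ones[OF assms(1)] unfolding one_index_def sorted_ones_Suc
  by (auto simp: nth_append)

lemma one_index_new:
  assumes "\<epsilon> \<in> {1..k} \<rightarrow>\<^sub>E {0, 1::nat}"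
  shows "one_index (Suc k) (\<epsilon>(Suc k := 1)) (Suc (\<Sum>j=1..k. \<epsilon> j)) = Suc k"
  using length_ones[OF assms] unfolding one_index_def sorted_ones_Suc
  by (simp add: nth_append)

lemma sum_update_Suc:
  fixes \<epsilon> :: "nat \<Rightarrow> nat"
  shows "(\<Sum>j=1..Suc k. (\<epsilon>(Suc k := e)) j) = (\<Sum>j=1..k. \<epsilon> j) + e"
  by simp

lemma last_one_update_0:
  assumes "\<epsilon> \<in> {1..k} \<rightarrow>\<^sub>E {0, 1::nat}"
  shows "last_one (Suc k) (\<epsilon>(Suc k := 0)) x = last_one k \<epsilon> x"
proof (cases "(\<Sum>i=1..k. \<epsilon> i) = 0")
  case False
  then have "one_index (Suc k) (\<epsilon>(Suc k := 0)) (\<Sum>i=1..k. \<epsilon> i) = one_index k \<epsilon> (\<Sum>i=1..k. \<epsilon> i)"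
    by (intro one_index_update[OF assms]) (simp only: atLeastAtMost_iff, linarith)
  then show ?thesis unfolding last_one_def sum_update_Suc by (simp only: add_0_right)
qed (simp only: last_one_def sum_update_Suc add_0_right simp_thms if_True)

lemma last_one_update_1:
  assumes "\<epsilon> \<in> {1..k} \<rightarrow>\<^sub>E {0, 1::nat}"
  shows "last_one (Suc k) (\<epsilon>(Suc k := 1)) x = x (Suc k)"
  unfolding last_one_def sum_update_Suc using one_index_new[OF assms] by auto

lemma last_one_bounds:
  assumes "\<epsilon> \<in> {1..k} \<rightarrow>\<^sub>E {0, 1::nat}" and x: "\<And>j. j \<in> {1..k} \<Longrightarrow> 0 \<le> x j \<and> x j \<le> b" "0 \<le> b"
  shows "0 \<le> last_one k \<epsilon> x" "last_one k \<epsilon> x \<le> b"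
proof -
  have "one_index k \<epsilon> s \<in> {1..k}" if "s = (\<Sum>i=1..k. \<epsilon> i)" "s \<noteq> 0" for s
  proof -
    have "one_index k \<epsilon> s \<in> set (sorted_list_of_set {j \<in> {1..k}. \<epsilon> j = 1})"
      unfolding one_index_def by (rule nth_mem) (use length_ones[OF assms(1)] that in linarith)
    then show ?thesis by simp
  qed
  then show "0 \<le> last_one k \<epsilon> x" "last_one k \<epsilon> x \<le> b"
    using x unfolding last_one_def by auto
qed

text \<open>
  A factor with \<open>\<epsilon> j = 1\<close> and \<open>n j = n (j - 1)\<close> contains \<open>n j - n (j - 1) = 0\<close>, so the summands
  that are 0 by convention are also 0 by their formula.
\<close>

lemma kendall_summand_eq_prod:
  assumes "\<epsilon> \<in> {1..k} \<rightarrow>\<^sub>E {0, 1::nat}"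
  shows "kendall_summand \<alpha> \<nu> k n x \<epsilon> =
    (\<Prod>i\<in>{1..<\<Sum>i=1..k. \<epsilon> i}. kendall_Psi \<alpha> (x (one_index k \<epsilon> i) / x (one_index k \<epsilon> (i + 1)))) *
    (\<Prod>j=1..k. kendall_G \<alpha> \<nu> (x j) ^ (n j - n (j - 1) - \<epsilon> j) *
       (real (n j - n (j - 1)) * kendall_H \<alpha> \<nu> (x j) / x j powr \<alpha>) ^ \<epsilon> j)"
proof (cases "\<exists>j\<in>{1..k}. \<epsilon> j = 1 \<and> n j = n (j - 1)")
  case True
  then obtain i where "i \<in> {1..k}" "\<epsilon> i = 1" "n i = n (i - 1)" by blast
  then have "(\<Prod>j=1..k. kendall_G \<alpha> \<nu> (x j) ^ (n j - n (j - 1) - \<epsilon> j) *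
       (real (n j - n (j - 1)) * kendall_H \<alpha> \<nu> (x j) / x j powr \<alpha>) ^ \<epsilon> j) = 0"
    by (intro prod_zero bexI[of _ i]) auto
  with True show ?thesis by (simp add: kendall_summand_def)
qed (auto simp: kendall_summand_def Let_def)

lemma kendall_summand_update_0:
  assumes "\<epsilon> \<in> {1..k} \<rightarrow>\<^sub>E {0, 1::nat}"
  shows "kendall_summand \<alpha> \<nu> (Suc k) n x (\<epsilon>(Suc k := 0)) =
    kendall_summand \<alpha> \<nu> k n x \<epsilon> * kendall_G \<alpha> \<nu> (x (Suc k)) ^ (n (Suc k) - n k)"
proof -
  have e: "\<epsilon>(Suc k := 0) \<in> {1..Suc k} \<rightarrow>\<^sub>E {0, 1}" using assms by (auto simp: PiE_iff extensional_def)
  have "(\<Prod>i\<in>{1..<\<Sum>i=1..k. \<epsilon> i}. kendall_Psi \<alpha>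
          (x (one_index (Suc k) (\<epsilon>(Suc k := 0)) i) / x (one_index (Suc k) (\<epsilon>(Suc k := 0)) (i + 1)))) =
        (\<Prod>i\<in>{1..<\<Sum>i=1..k. \<epsilon> i}. kendall_Psi \<alpha> (x (one_index k \<epsilon> i) / x (one_index k \<epsilon> (i + 1))))"
    using one_index_update[OF assms] by (intro prod.cong) auto
  then show ?thesis
    unfolding kendall_summand_eq_prod[OF assms] kendall_summand_eq_prod[OF e] sum_update_Suc
    by simp
qed

text \<open>
  A new one at the end adds a factor to the product of \<open>\<Psi>\<close> values, linking the previous last one
  to the new barrier. Since \<open>last_one k \<epsilon> x \<le> x (Suc k)\<close>, the positive part in \<open>\<Psi>\<close> is attained by
  the difference itself.
\<close>

lemma kendall_summand_update_1:
  assumes "\<epsilon> \<in> {1..k} \<rightarrow>\<^sub>E {0, 1::nat}" "\<alpha> > 0"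
    and x: "\<And>j. j \<in> {1..k} \<Longrightarrow> 0 \<le> x j \<and> x j \<le> x (Suc k)" "0 < x (Suc k)"
  shows "kendall_summand \<alpha> \<nu> (Suc k) n x (\<epsilon>(Suc k := 1)) =
    kendall_summand \<alpha> \<nu> k n x \<epsilon> * (1 - last_one k \<epsilon> x powr \<alpha> / x (Suc k) powr \<alpha>) *
    (kendall_G \<alpha> \<nu> (x (Suc k)) ^ (n (Suc k) - n k - 1) *
     (real (n (Suc k) - n k) * kendall_H \<alpha> \<nu> (x (Suc k)) / x (Suc k) powr \<alpha>))"
proof -
  define s where "s = (\<Sum>i=1..k. \<epsilon> i)"
  define g where "g = \<epsilon>(Suc k := 1)"
  have e: "g \<in> {1..Suc k} \<rightarrow>\<^sub>E {0, 1}" using assms by (auto simp: g_def PiE_iff extensional_def)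
  have s': "(\<Sum>i=1..Suc k. g i) = Suc s" unfolding g_def sum_update_Suc s_def by simp
  have old: "one_index (Suc k) g i = one_index k \<epsilon> i" if "i \<in> {1..s}" for i
    using one_index_update[OF assms(1)] that unfolding s_def g_def by blast
  have new: "one_index (Suc k) g (Suc s) = Suc k"
    using one_index_new[OF assms(1)] unfolding s_def g_def .
  have b: "0 \<le> last_one k \<epsilon> x" "last_one k \<epsilon> x \<le> x (Suc k)"
    using last_one_bounds[OF assms(1), of x "x (Suc k)"] x by auto
  then have le: "last_one k \<epsilon> x powr \<alpha> \<le> x (Suc k) powr \<alpha>"
    using assms(2) by (intro powr_mono2) auto
  have Psi: "kendall_Psi \<alpha> (last_one k \<epsilon> x / x (Suc k)) = 1 - last_one k \<epsilon> x powr \<alpha> / x (Suc k) powr \<alpha>"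
    using b x(2) le by (auto simp: kendall_Psi_def powr_divide divide_le_eq_1)
  have "(\<Prod>i\<in>{1..<Suc s}. kendall_Psi \<alpha> (x (one_index (Suc k) g i) / x (one_index (Suc k) g (i + 1)))) =
        (\<Prod>i\<in>{1..<s}. kendall_Psi \<alpha> (x (one_index k \<epsilon> i) / x (one_index k \<epsilon> (i + 1)))) *
        (1 - last_one k \<epsilon> x powr \<alpha> / x (Suc k) powr \<alpha>)"
  proof (cases "s = 0")
    case True
    then have "last_one k \<epsilon> x = 0" unfolding last_one_def s_def by (simp only: simp_thms if_True)
    then show ?thesis using True by simp
  next
    case False
    then have "last_one k \<epsilon> x = x (one_index k \<epsilon> s)"
      unfolding last_one_def s_def by (simp only: if_False)
    moreover have "(\<Prod>i\<in>{1..<s}. kendall_Psi \<alpha> (x (one_index (Suc k) g i) / x (one_index (Suc k) g (i + 1)))) =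
      (\<Prod>i\<in>{1..<s}. kendall_Psi \<alpha> (x (one_index k \<epsilon> i) / x (one_index k \<epsilon> (i + 1))))"
      using old by (intro prod.cong) auto
    ultimately show ?thesis
      using False old[of s] new Psi by (simp add: prod.atLeastLessThan_Suc)
  qed
  moreover have "(\<Prod>j=1..k. kendall_G \<alpha> \<nu> (x j) ^ (n j - n (j - 1) - g j) *
       (real (n j - n (j - 1)) * kendall_H \<alpha> \<nu> (x j) / x j powr \<alpha>) ^ g j) =
     (\<Prod>j=1..k. kendall_G \<alpha> \<nu> (x j) ^ (n j - n (j - 1) - \<epsilon> j) *
       (real (n j - n (j - 1)) * kendall_H \<alpha> \<nu> (x j) / x j powr \<alpha>) ^ \<epsilon> j)"
    by (intro prod.cong) (auto simp: g_def)
  ultimately show ?thesis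
    unfolding kendall_summand_eq_prod[OF assms(1)] g_def [symmetric] kendall_summand_eq_prod[OF e] s' s_def [symmetric]
    by (simp add: g_def)
qed

lemma sum_binary_Suc:
  fixes f :: "(nat \<Rightarrow> nat) \<Rightarrow> real"
  shows "(\<Sum>\<epsilon>\<in>{1..Suc k} \<rightarrow>\<^sub>E {0, 1}. f \<epsilon>) =
    (\<Sum>\<epsilon>\<in>{1..k} \<rightarrow>\<^sub>E {0, 1}. f (\<epsilon>(Suc k := 0)) + f (\<epsilon>(Suc k := 1)))"
proof -
  have ins: "{1..Suc k} = insert (Suc k) {1..k}" by auto
  have "(\<Sum>\<epsilon>\<in>{1..Suc k} \<rightarrow>\<^sub>E {0, 1}. f \<epsilon>) =
     (\<Sum>(e, \<epsilon>)\<in>{0, 1} \<times> ({1..k} \<rightarrow>\<^sub>E {0, 1}). f (\<epsilon>(Suc k := e)))"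
    unfolding ins PiE_insert_eq
    by (subst sum.reindex[OF inj_combinator]) (auto simp: case_prod_unfold)
  also have "\<dots> = (\<Sum>e\<in>{0, 1}. \<Sum>\<epsilon>\<in>{1..k} \<rightarrow>\<^sub>E {0, 1}. f (\<epsilon>(Suc k := e)))"
    by (simp add: sum.cartesian_product)
  finally show ?thesis by (simp add: sum.distrib)
qed

section \<open>Independence and product laws\<close>

text \<open>
  Independent families of independent variables form one independent doubly indexed family: a
  finite intersection of events is sorted by rows. The events of one row \<open>i\<close> are together a
  cylinder event of the sequence \<open>Z i\<close>, so that independence of the sequences separates the
  rows, and independence inside each sequence separates the events of a row.
\<close>

lemma (in prob_space) indep_vars_Times:
  assumes rows: "\<And>i. i \<in> I \<Longrightarrow> indep_vars (N i) (Z i) K"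
    and seqs: "indep_vars (\<lambda>i. PiM K (N i)) (\<lambda>i \<omega>. \<lambda>k\<in>K. Z i k \<omega>) I"
  shows "indep_vars (\<lambda>(i, k). N i k) (\<lambda>(i, k). Z i k) (I \<times> K)"
  unfolding indep_vars_def2
proof (intro conjI ballI indep_setsI)
  have rv: "random_variable (N i k) (Z i k)" if "i \<in> I" "k \<in> K" for i k
    using rows[OF that(1)] that(2) by (auto simp: indep_vars_def2)
  show "random_variable (case p of (i, k) \<Rightarrow> N i k) (case p of (i, k) \<Rightarrow> Z i k)" if "p \<in> I \<times> K" for p
    using rv that by auto
  show "{(case p of (i, k) \<Rightarrow> Z i k) -` A \<inter> space M |A. A \<in> sets (case p of (i, k) \<Rightarrow> N i k)} \<subseteq> events"
    if "p \<in> I \<times> K" for p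
    using rv that by (auto intro!: measurable_sets)
  fix A and J :: "('b \<times> 'c) set"
  assume J: "J \<noteq> {}" "J \<subseteq> I \<times> K" "finite J"
    and A: "\<forall>p\<in>J. A p \<in> {(case p of (i, k) \<Rightarrow> Z i k) -` A \<inter> space M |A. A \<in> sets (case p of (i, k) \<Rightarrow> N i k)}"
  have "\<forall>p\<in>J. \<exists>C. C \<in> sets (N (fst p) (snd p)) \<and> A p = Z (fst p) (snd p) -` C \<inter> space M"
    using A by (fastforce simp: case_prod_unfold)
  then obtain C where C: "\<And>i k. (i, k) \<in> J \<Longrightarrow> C (i, k) \<in> sets (N i k)"
    "\<And>i k. (i, k) \<in> J \<Longrightarrow> A (i, k) = Z i k -` C (i, k) \<inter> space M"
    unfolding bchoice_iff by force
  define S where "S i = {k. (i, k) \<in> J}" for i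
  have S: "finite (S i)" "S i \<subseteq> K" for i
    using J(2) finite_subset[of "S i" "snd ` J"] J(3) by (force simp: S_def)+
  have I': "fst ` J \<subseteq> I" "fst ` J \<noteq> {}" "finite (fst ` J)" using J by auto
  have S_ne: "S i \<noteq> {}" if "i \<in> fst ` J" for i using that by (force simp: S_def)
  have J_eq: "J = Sigma (fst ` J) S" by (force simp: S_def)
  have row_event: "(\<Inter>k\<in>S i. A (i, k)) \<in> {(\<lambda>\<omega>. \<lambda>k\<in>K. Z i k \<omega>) -` B \<inter> space M |B. B \<in> sets (PiM K (N i))}"
    if "i \<in> fst ` J" for i
  proof (intro CollectI exI conjI)
    show "{f \<in> space (PiM K (N i)). \<forall>k\<in>S i. f k \<in> C (i, k)} \<in> sets (PiM K (N i))"
    proof (rule sets.sets_Collect_finite_All[OF _ S(1)])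
      fix k assume k: "k \<in> S i"
      then have "(\<lambda>f. f k) -` C (i, k) \<inter> space (PiM K (N i)) \<in> sets (PiM K (N i))"
        using C(1)[of i k] S(2)[of i]
        by (intro measurable_sets[OF measurable_component_singleton]) (auto simp: S_def)
      then show "{f \<in> space (PiM K (N i)). f k \<in> C (i, k)} \<in> sets (PiM K (N i))"
        by (simp add: vimage_def Int_def conj_commute)
    qed
    have sp: "(\<lambda>k\<in>K. Z i k \<omega>) \<in> space (PiM K (N i))" if "\<omega> \<in> space M" for \<omega>
      using that rv[of i] \<open>i \<in> fst ` J\<close> I'(1) by (auto simp: space_PiM dest: measurable_space)
    show "(\<Inter>k\<in>S i. A (i, k)) =
      (\<lambda>\<omega>. \<lambda>k\<in>K. Z i k \<omega>) -` {f \<in> space (PiM K (N i)). \<forall>k\<in>S i. f k \<in> C (i, k)} \<inter> space M"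
      using S_ne[OF that] S(2)[of i] C(2) sp by (auto simp: S_def)
  qed
  have "prob (\<Inter>p\<in>J. A p) = prob (\<Inter>i\<in>fst ` J. \<Inter>k\<in>S i. A (i, k))"
    by (subst J_eq) (rule arg_cong[where f=prob], auto)
  also have "\<dots> = (\<Prod>i\<in>fst ` J. prob (\<Inter>k\<in>S i. A (i, k)))"
  proof (rule indep_setsD[OF _ I'])
    show "indep_sets (\<lambda>i. {(\<lambda>\<omega>. \<lambda>k\<in>K. Z i k \<omega>) -` B \<inter> space M |B. B \<in> sets (PiM K (N i))}) I"
      using seqs unfolding indep_vars_def2 by blast
  qed (use row_event in blast)
  also have "\<dots> = (\<Prod>i\<in>fst ` J. \<Prod>k\<in>S i. prob (A (i, k)))"
  proof (intro prod.cong refl)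
    fix i assume i: "i \<in> fst ` J"
    then have "i \<in> I" using I' by auto
    then show "prob (\<Inter>k\<in>S i. A (i, k)) = (\<Prod>k\<in>S i. prob (A (i, k)))"
      using rows[of i] S S_ne[OF i] C unfolding indep_vars_def2
      by (intro indep_setsD[where I=K]) (auto simp: S_def)
  qed
  also have "\<dots> = (\<Prod>p\<in>Sigma (fst ` J) S. prob (A p))"
    using I' S by (simp add: prod.Sigma)
  finally show "prob (\<Inter>p\<in>J. A p) = (\<Prod>p\<in>J. prob (A p))" using J_eq by simp
qed

text \<open>
  Rectangles generate the product \<open>\<sigma>\<close>-algebra, so independence of two random elements, whose
  value types may be different, determines their joint law.
\<close>

lemma (in prob_space) distr_pair_eqI:
  assumes [measurable]: "random_variable S X" "random_variable T Y"
    and indep: "\<And>A C. A \<in> sets S \<Longrightarrow> C \<in> sets T \<Longrightarrow>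
      prob ((X -` A \<inter> space M) \<inter> (Y -` C \<inter> space M)) = prob (X -` A \<inter> space M) * prob (Y -` C \<inter> space M)"
  shows "distr M (S \<Otimes>\<^sub>M T) (\<lambda>\<omega>. (X \<omega>, Y \<omega>)) = distr M S X \<Otimes>\<^sub>M distr M T Y"
proof -
  interpret X: prob_space "distr M S X" by (rule prob_space_distr) fact
  interpret Y: prob_space "distr M T Y" by (rule prob_space_distr) fact
  have "distr M S X \<Otimes>\<^sub>M distr M T Y = distr M (S \<Otimes>\<^sub>M T) (\<lambda>\<omega>. (X \<omega>, Y \<omega>))"
  proof (rule pair_measure_eqI)
    fix A C assume "A \<in> sets (distr M S X)" "C \<in> sets (distr M T Y)"
    then have [measurable]: "A \<in> sets S" "C \<in> sets T" by auto
    have "(\<lambda>\<omega>. (X \<omega>, Y \<omega>)) -` (A \<times> C) \<inter> space M = (X -` A \<inter> space M) \<inter> (Y -` C \<inter> space M)"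
      by auto
    then show "emeasure (distr M S X) A * emeasure (distr M T Y) C =
        emeasure (distr M (S \<Otimes>\<^sub>M T) (\<lambda>\<omega>. (X \<omega>, Y \<omega>))) (A \<times> C)"
      using indep[of A C] by (simp add: emeasure_distr emeasure_eq_measure ennreal_mult)
  qed (auto intro: X.sigma_finite_measure_axioms Y.sigma_finite_measure_axioms cong: sets_pair_measure_cong)
  then show ?thesis by simp
qed

lemma integral_pair_bounded:
  fixes f :: "'b \<times> 'c \<Rightarrow> real"
  assumes "prob_space M1" "prob_space M2" "f \<in> borel_measurable (M1 \<Otimes>\<^sub>M M2)" "\<And>z. \<bar>f z\<bar> \<le> B"
  shows "integral\<^sup>L (M1 \<Otimes>\<^sub>M M2) f = (LINT x|M1. LINT y|M2. f (x, y))"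
proof -
  interpret M1: prob_space M1 by fact
  interpret M2: prob_space M2 by fact
  interpret P: pair_prob_space M1 M2 ..
  have "integrable (M1 \<Otimes>\<^sub>M M2) f"
    using assms by (intro P.integrable_const_bound[of _ B]) auto
  then show ?thesis by (rule P.integral_fst' [symmetric])
qed

section \<open>Averaging the kernel over the unit step\<close>

context kendall_random_walk
begin

lemma measurable_\<nu> [measurable_cong]: "sets \<nu> = sets borel"
  by (rule sets_\<nu>)

sublocale \<nu>: prob_space \<nu>
  by (rule prob_space_\<nu>)

lemma AE_\<nu>_nonneg: "AE y in \<nu>. 0 \<le> y"
  using \<nu>.AE_prob_1[OF \<nu>_nonneg] by simp

lemma indicator_powr_integrable:
  "integrable \<nu> (\<lambda>y. indicator {0..x} y * y powr \<alpha>)"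
proof (rule \<nu>.integrable_const_bound[of _ "x powr \<alpha>"])
  show "AE y in \<nu>. norm (indicator {0..x} y * y powr \<alpha>) \<le> x powr \<alpha>"
    using \<alpha>_pos by (intro AE_I2) (auto simp: indicator_def intro!: powr_mono2)
qed measurable

lemma kendall_H_eq: "kendall_H \<alpha> \<nu> x = (LINT y|\<nu>. indicator {0..x} y * y powr \<alpha>)"
  by (simp add: kendall_H_def set_lebesgue_integral_def)

text \<open>
  Here \<open>\<Psi>(y / x)\<close> is \<open>1 - y\<^sup>\<alpha> / x\<^sup>\<alpha>\<close> on \<open>[0, x]\<close> and 0 beyond. Read in the other direction, this
  expresses the mass of \<open>[0, x]\<close> by \<open>G\<close> and \<open>H\<close>, which is what brings \<open>G\<close> into the kernel.
\<close>

lemma kendall_G_eq: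
  assumes "x > 0"
  shows "kendall_G \<alpha> \<nu> x = measure \<nu> {0..x} - kendall_H \<alpha> \<nu> x / x powr \<alpha>"
proof -
  have "kendall_G \<alpha> \<nu> x = (LINT y|\<nu>. indicator {0..x} y - indicator {0..x} y * y powr \<alpha> / x powr \<alpha>)"
    unfolding kendall_G_def set_lebesgue_integral_def
  proof (intro Bochner_Integration.integral_cong refl)
    fix y :: real
    have "y powr \<alpha> \<le> x powr \<alpha> \<longleftrightarrow> y \<le> x" if "y \<ge> 0"
      using that assms \<alpha>_pos by (meson less_imp_le not_le powr_less_mono2 powr_mono2)
    then show "indicator {0..} y *\<^sub>R kendall_Psi \<alpha> (y / x) =
        indicator {0..x} y - indicator {0..x} y * y powr \<alpha> / x powr \<alpha>"
      using assms by (auto simp: kendall_Psi_def indicator_def powr_divide divide_le_eq_1 max_def)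
  qed
  also have "\<dots> = measure \<nu> {0..x} - kendall_H \<alpha> \<nu> x / x powr \<alpha>"
    unfolding kendall_H_eq using indicator_powr_integrable[of x] sets_\<nu>
    by (subst Bochner_Integration.integral_diff) (auto simp: \<nu>.emeasure_eq_measure)
  finally show ?thesis .
qed

lemma integral_\<nu>_affine:
  "(LINT y|\<nu>. indicator {0..x} y * (a + b * y powr \<alpha>)) = a * measure \<nu> {0..x} + b * kendall_H \<alpha> \<nu> x"
proof -
  have "(LINT y|\<nu>. indicator {0..x} y * (a + b * y powr \<alpha>)) =
    (LINT y|\<nu>. a * indicator {0..x} y + b * (indicator {0..x} y * y powr \<alpha>))"
    by (intro Bochner_Integration.integral_cong) (auto simp: algebra_simps)
  also have "\<dots> = a * measure \<nu> {0..x} + b * kendall_H \<alpha> \<nu> x"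
    unfolding kendall_H_eq using indicator_powr_integrable[of x] sets_\<nu>
    by (subst Bochner_Integration.integral_add) (auto simp: \<nu>.emeasure_eq_measure)
  finally show ?thesis .
qed

text \<open>
  The first step leads from 0 to \<open>Y 1\<close>, and this is \<open>integral_transition\<close> at \<open>u = 0\<close>, where both
  test functions have the value 1. It is kept apart because no \<open>\<xi>\<close> takes part in this step.
\<close>

lemma integral_first_step:
  assumes "x > 0"
  shows "(LINT y|\<nu>. kendall_test \<alpha> x c y) =
    kendall_G \<alpha> \<nu> x + kendall_H \<alpha> \<nu> x / x powr \<alpha> * (1 - c * x powr \<alpha>)"
proof -
  have "(LINT y|\<nu>. kendall_test \<alpha> x c y) = measure \<nu> {0..x} - c * kendall_H \<alpha> \<nu> x"
    using integral_\<nu>_affine[of x 1 "-c"] by (simp add: kendall_test_def)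
  then show ?thesis using assms by (simp add: kendall_G_eq [OF assms] right_diff_distrib)
qed

text \<open>
  The triangular action of the transition operator on the test functions. The integrand is affine
  in \<open>y\<^sup>\<alpha>\<close> on \<open>[0, x]\<close>; after the substitution \<open>\<nu>[0, x] = G(x) + H(x) / x\<^sup>\<alpha>\<close> the terms
  with \<open>H\<close> factor into \<open>(1 - c x\<^sup>\<alpha>) (1 - u\<^sup>\<alpha> / x\<^sup>\<alpha>)\<close>.
\<close>

lemma integral_transition:
  assumes "x > 0" "u \<ge> 0"
  shows "(LINT y|\<nu>. LINT s|unit_uniform. LINT t|pareto \<alpha>. kendall_test \<alpha> x c (kendall_step \<alpha> u y s t)) =
    kendall_G \<alpha> \<nu> x * kendall_test \<alpha> x c u +
    kendall_H \<alpha> \<nu> x / x powr \<alpha> * (1 - c * x powr \<alpha>) * kendall_test \<alpha> x (1 / x powr \<alpha>) u"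
    (is "?I = ?R")
proof -
  interpret P: prob_space "pareto \<alpha>" by (rule prob_space_pareto[OF \<alpha>_pos])
  interpret U: prob_space unit_uniform by (rule prob_space_unit_uniform)
  define p where "p = u powr \<alpha>"
  define X where "X = x powr \<alpha>"
  have X: "X > 0" using assms by (simp add: X_def)
  have "?I = (LINT y|\<nu>. indicator {0..x} u *
     (indicator {0..x} y * ((1 - c * p) + (2 * c * p / X - c - p / X\<^sup>2) * y powr \<alpha>)))"
  proof (rule integral_cong_AE)
    show "AE y in \<nu>. (LINT s|unit_uniform. LINT t|pareto \<alpha>. kendall_test \<alpha> x c (kendall_step \<alpha> u y s t)) =
       indicator {0..x} u *
     (indicator {0..x} y * ((1 - c * p) + (2 * c * p / X - c - p / X\<^sup>2) * y powr \<alpha>))"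
      using AE_\<nu>_nonneg
    proof eventually_elim
      case (elim y)
      then show ?case
        using assms \<alpha>_pos unfolding p_def X_def
        by (subst integral_kendall_step) (auto simp: indicator_def algebra_simps)
    qed
  qed measurable
  also have "\<dots> = indicator {0..x} u * ((1 - c * p) * measure \<nu> {0..x} +
      (2 * c * p / X - c - p / X\<^sup>2) * kendall_H \<alpha> \<nu> x)"
    by (simp only: integral_mult_right_zero integral_\<nu>_affine)
  also have "measure \<nu> {0..x} = kendall_G \<alpha> \<nu> x + kendall_H \<alpha> \<nu> x / X"
    using kendall_G_eq[OF assms(1)] by (simp add: X_def)
  also have "indicator {0..x} u * ((1 - c * p) * (kendall_G \<alpha> \<nu> x + kendall_H \<alpha> \<nu> x / X) +
      (2 * c * p / X - c - p / X\<^sup>2) * kendall_H \<alpha> \<nu> x) = ?R"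
    unfolding kendall_test_def p_def [symmetric] X_def [symmetric]
    using X by (simp add: field_simps power2_eq_square)
  finally show ?thesis .
qed

section \<open>The history of the walk\<close>

definition coord :: "nat \<times> nat \<Rightarrow> 'a \<Rightarrow> real" where
  "coord = (\<lambda>(i, k). ([Y, \<xi>, \<theta>] ! i) k)"

text \<open>
  The coordinates that determine the walk up to time \<open>n\<close>. The step from \<open>k\<close> to \<open>k + 1\<close>
  uses \<open>\<xi> k\<close>, so \<open>\<xi> n\<close> does not belong to the past of time \<open>n\<close>.
\<close>

definition past :: "nat \<Rightarrow> (nat \<times> nat) set" where
  "past n = {0} \<times> {1..n} \<union> {1} \<times> {1..<n} \<union> {2} \<times> {1..n}"

text \<open>
  The \<open>\<sigma>\<close>-algebra generated by the past, as a measure space on the sample space itself. In this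
  form events and the walk can be measurable with respect to the past without being written as
  functions of the coordinates.
\<close>

definition history :: "nat \<Rightarrow> 'a measure" where
  "history n = vimage_algebra (space M) (\<lambda>\<omega>. \<lambda>p\<in>past n. coord p \<omega>) (PiM (past n) (\<lambda>_. borel))"

text \<open>
  The walk started from 0 instead of 1. Since \<open>X 1 = Y 1\<close>, the first step does not depend on
  \<open>X 0\<close>; a step of the walk from 0 leads almost surely to the value of \<open>Y\<close>, and
  so the start at 0 is the one for which the first step obeys the same formulas as the later ones.
\<close>

definition walk :: "nat \<Rightarrow> 'a \<Rightarrow> real" where
  "walk n \<omega> = (if n = 0 then 0 else X n \<omega>)"

lemma indep_coord: "indep_vars (\<lambda>_. borel) coord ({0, 1, 2} \<times> {1..})"
proof -
  have "indep_vars (\<lambda>(i, k). borel) (\<lambda>(i, k). ([Y, \<xi>, \<theta>] ! i) k) ({0, 1, 2} \<times> {1..})"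
    using indep_Y indep_\<xi> indep_\<theta> indep_seqs by (intro indep_vars_Times) auto
  then show ?thesis by (simp add: coord_def case_prod_unfold)
qed

lemma measurable_coord:
  assumes "fst p \<in> {0, 1, 2}" "snd p \<ge> 1" shows "coord p \<in> borel_measurable M"
proof -
  have "p \<in> {0, 1, 2} \<times> {1..}" using assms by (simp add: mem_Times_iff)
  then show ?thesis using indep_coord unfolding indep_vars_def2 by blast
qed

lemma measurable_inputs:
  assumes "k \<ge> 1"
  shows "Y k \<in> borel_measurable M" "\<xi> k \<in> borel_measurable M" "\<theta> k \<in> borel_measurable M"
  using measurable_coord[of "(0, k)"] measurable_coord[of "(1, k)"] measurable_coord[of "(2, k)"] assms
  by (auto simp: coord_def)

lemma space_history [simp]: "space (history n) = space M"
  by (simp add: history_def)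

lemma measurable_history_coord:
  assumes "p \<in> past n" shows "coord p \<in> borel_measurable (history n)"
proof -
  have "(\<lambda>\<omega>. \<lambda>p\<in>past n. coord p \<omega>) \<in> measurable (history n) (PiM (past n) (\<lambda>_. borel))"
    unfolding history_def by (rule measurable_vimage_algebra1) (auto simp: space_PiM)
  from measurable_compose[OF this measurable_component_singleton[OF assms]]
  show ?thesis using assms by simp
qed

lemma measurable_ident_history: "(\<lambda>\<omega>. \<omega>) \<in> measurable M (history n)"
  unfolding history_def
proof (rule measurable_vimage_algebra2)
  show "(\<lambda>\<omega>. \<lambda>p\<in>past n. coord p \<omega>) \<in> measurable M (PiM (past n) (\<lambda>_. borel))"
    by (rule measurable_restrict) (auto simp: past_def intro!: measurable_coord)
qed auto

lemma walk_Suc_0: "\<omega> \<in> space M \<Longrightarrow> walk (Suc 0) \<omega> = Y 1 \<omega>"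
  using X_1 by (simp add: walk_def)

lemma walk_Suc:
  assumes "n \<ge> 1" "\<omega> \<in> space M"
  shows "walk (Suc n) \<omega> = kendall_step \<alpha> (walk n \<omega>) (Y (Suc n) \<omega>) (\<xi> n \<omega>) (\<theta> (Suc n) \<omega>)"
  using X_step[OF assms] assms(1) by (simp add: walk_def kendall_step_def)

lemma measurable_walk_history:
  "n \<le> m \<Longrightarrow> walk n \<in> borel_measurable (history m)"
proof (induction n)
  case 0
  then show ?case by (simp add: walk_def [abs_def])
next
  case (Suc n)
  have Ym: "Y (Suc n) \<in> borel_measurable (history m)"
    using measurable_history_coord[of "(0, Suc n)" m] Suc.prems by (simp add: coord_def past_def)
  show ?case
  proof (cases "n = 0")
    case True
    then show ?thesis using Ym walk_Suc_0 by (subst measurable_cong[where g="Y (Suc 0)"]) auto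
  next
    case False
    have [measurable]: "walk n \<in> borel_measurable (history m)"
      "Y (Suc n) \<in> borel_measurable (history m)" "\<xi> n \<in> borel_measurable (history m)"
      "\<theta> (Suc n) \<in> borel_measurable (history m)"
      using measurable_history_coord[of "(1, n)" m] measurable_history_coord[of "(2, Suc n)" m]
        Suc Ym False by (simp_all add: coord_def past_def)
    have "(\<lambda>\<omega>. kendall_step \<alpha> (walk n \<omega>) (Y (Suc n) \<omega>) (\<xi> n \<omega>) (\<theta> (Suc n) \<omega>)) \<in> borel_measurable (history m)"
      by measurable
    then show ?thesis using walk_Suc[of n] False by (subst measurable_cong) auto
  qed
qed

lemma measurable_walk [measurable]: "walk n \<in> borel_measurable M"
  using measurable_compose[OF measurable_ident_history measurable_walk_history[OF order_refl]] .

lemma sets_history_subset: "A \<in> sets (history n) \<Longrightarrow> A \<in> sets M"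
  using measurable_sets[OF measurable_ident_history[of n], of A] sets.sets_into_space[of A "history n"]
  by (simp add: Int_absorb2 vimage_def)

text \<open>
  The sample point, seen through the past, is independent of the three variables that drive the
  next step, and these are independent of each other. Pairing the law of the sample point on
  \<open>history n\<close> with the laws of \<open>Y\<close>, \<open>\<xi>\<close> and \<open>\<theta>\<close> makes the Markov property an instance of
  Fubini's theorem.
\<close>

lemma distr_history:
  assumes "n \<ge> 1"
  shows "distr M (history n \<Otimes>\<^sub>M (borel \<Otimes>\<^sub>M (borel \<Otimes>\<^sub>M borel)))
      (\<lambda>\<omega>. (\<omega>, Y (Suc n) \<omega>, \<xi> n \<omega>, \<theta> (Suc n) \<omega>)) =
    distr M (history n) (\<lambda>\<omega>. \<omega>) \<Otimes>\<^sub>M (\<nu> \<Otimes>\<^sub>M (unit_uniform \<Otimes>\<^sub>M pareto \<alpha>))"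
proof -
  let ?r = "\<lambda>A \<omega>. \<lambda>p\<in>A. coord p \<omega>"
  let ?P = "\<lambda>A. PiM A (\<lambda>_::nat \<times> nat. borel :: real measure)"
  let ?new = "\<lambda>f. (f (0, Suc n), f (1, n), f (2, Suc n)) :: real \<times> real \<times> real"
  define B :: "(nat \<times> nat) set" where "B = {(0, Suc n), (1, n), (2, Suc n)}"
  have indep: "indep_var (?P I) (?r I) (?P J) (?r J)"
    if "I \<inter> J = {}" "I \<union> J \<subseteq> past n \<union> B" for I J
    using assms that by (intro indep_var_restrict[OF indep_coord]) (auto simp: past_def B_def)
  note [measurable] = measurable_inputs(1)[of "Suc n"] measurable_inputs(2)[OF assms] measurable_inputs(3)[of "Suc n"]
  have "distr M (history n \<Otimes>\<^sub>M (borel \<Otimes>\<^sub>M (borel \<Otimes>\<^sub>M borel))) (\<lambda>\<omega>. (\<omega>, Y (Suc n) \<omega>, \<xi> n \<omega>, \<theta> (Suc n) \<omega>)) =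
    distr M (history n) (\<lambda>\<omega>. \<omega>) \<Otimes>\<^sub>M distr M (borel \<Otimes>\<^sub>M (borel \<Otimes>\<^sub>M borel)) (\<lambda>\<omega>. (Y (Suc n) \<omega>, \<xi> n \<omega>, \<theta> (Suc n) \<omega>))"
  proof (rule distr_pair_eqI[OF measurable_ident_history])
    show "random_variable (borel \<Otimes>\<^sub>M (borel \<Otimes>\<^sub>M borel)) (\<lambda>\<omega>. (Y (Suc n) \<omega>, \<xi> n \<omega>, \<theta> (Suc n) \<omega>))"
      by simp
    fix A C assume A: "A \<in> sets (history n)" and C: "C \<in> sets (borel \<Otimes>\<^sub>M (borel \<Otimes>\<^sub>M borel) :: (real \<times> real \<times> real) measure)"
    have "?r (past n) \<in> space M \<rightarrow> space (?P (past n))" by (auto simp: space_PiM)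
    then obtain A' where A': "A' \<in> sets (?P (past n))" "A = ?r (past n) -` A' \<inter> space M"
      using A unfolding history_def by (auto simp: sets_vimage_algebra2)
    have "?new \<in> measurable (?P B) (borel \<Otimes>\<^sub>M (borel \<Otimes>\<^sub>M borel))"
      by (intro measurable_Pair measurable_component_singleton) (auto simp: B_def)
    then have C': "?new -` C \<inter> space (?P B) \<in> sets (?P B)"
      using C by (rule measurable_sets)
    have "prob ((\<lambda>\<omega>. (?r (past n) \<omega>, ?r B \<omega>)) -` (A' \<times> (?new -` C \<inter> space (?P B))) \<inter> space M) =
      prob (?r (past n) -` A' \<inter> space M) * prob (?r B -` (?new -` C \<inter> space (?P B)) \<inter> space M)"
      by (rule indep_varD[OF indep A'(1) C']) (auto simp: past_def B_def)
    also have "(\<lambda>\<omega>. (?r (past n) \<omega>, ?r B \<omega>)) -` (A' \<times> (?new -` C \<inter> space (?P B))) \<inter> space M =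
        A \<inter> ((\<lambda>\<omega>. (Y (Suc n) \<omega>, \<xi> n \<omega>, \<theta> (Suc n) \<omega>)) -` C \<inter> space M)"
      by (auto simp: A' B_def coord_def space_PiM)
    also have "?r B -` (?new -` C \<inter> space (?P B)) \<inter> space M =
        (\<lambda>\<omega>. (Y (Suc n) \<omega>, \<xi> n \<omega>, \<theta> (Suc n) \<omega>)) -` C \<inter> space M"
      by (auto simp: B_def coord_def space_PiM)
    also have "?r (past n) -` A' \<inter> space M = A" by (rule A'(2) [symmetric])
    also have "A = (\<lambda>\<omega>. \<omega>) -` A \<inter> space M" using A'(2) by auto
    finally show "prob (((\<lambda>\<omega>. \<omega>) -` A \<inter> space M) \<inter> ((\<lambda>\<omega>. (Y (Suc n) \<omega>, \<xi> n \<omega>, \<theta> (Suc n) \<omega>)) -` C \<inter> space M)) =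
      prob ((\<lambda>\<omega>. \<omega>) -` A \<inter> space M) *
      prob ((\<lambda>\<omega>. (Y (Suc n) \<omega>, \<xi> n \<omega>, \<theta> (Suc n) \<omega>)) -` C \<inter> space M)" .
  qed
  also have "distr M (borel \<Otimes>\<^sub>M (borel \<Otimes>\<^sub>M borel)) (\<lambda>\<omega>. (Y (Suc n) \<omega>, \<xi> n \<omega>, \<theta> (Suc n) \<omega>)) =
    distr M borel (Y (Suc n)) \<Otimes>\<^sub>M distr M (borel \<Otimes>\<^sub>M borel) (\<lambda>\<omega>. (\<xi> n \<omega>, \<theta> (Suc n) \<omega>))"
  proof (rule distr_pair_eqI)
    fix A :: "real set" and C :: "(real \<times> real) set"
    assume A: "A \<in> sets borel" and C: "C \<in> sets (borel \<Otimes>\<^sub>M borel)"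
    let ?B1 = "{(0, Suc n)} :: (nat \<times> nat) set" and ?B2 = "{(1, n), (2, Suc n)} :: (nat \<times> nat) set"
    have A': "(\<lambda>f. f (0, Suc n)) -` A \<inter> space (?P ?B1) \<in> sets (?P ?B1)"
      by (rule measurable_sets[OF _ A]) (intro measurable_component_singleton, simp)
    have C': "(\<lambda>f. (f (1, n), f (2, Suc n))) -` C \<inter> space (?P ?B2) \<in> sets (?P ?B2)"
      by (rule measurable_sets[OF _ C]) (intro measurable_Pair measurable_component_singleton, auto)
    have "prob ((\<lambda>\<omega>. (?r ?B1 \<omega>, ?r ?B2 \<omega>)) -` (((\<lambda>f. f (0, Suc n)) -` A \<inter> space (?P ?B1)) \<times>
          ((\<lambda>f. (f (1, n), f (2, Suc n))) -` C \<inter> space (?P ?B2))) \<inter> space M) =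
      prob (?r ?B1 -` ((\<lambda>f. f (0, Suc n)) -` A \<inter> space (?P ?B1)) \<inter> space M) *
      prob (?r ?B2 -` ((\<lambda>f. (f (1, n), f (2, Suc n))) -` C \<inter> space (?P ?B2)) \<inter> space M)"
      by (rule indep_varD[OF indep A' C']) (auto simp: B_def)
    also have "(\<lambda>\<omega>. (?r ?B1 \<omega>, ?r ?B2 \<omega>)) -` (((\<lambda>f. f (0, Suc n)) -` A \<inter> space (?P ?B1)) \<times>
          ((\<lambda>f. (f (1, n), f (2, Suc n))) -` C \<inter> space (?P ?B2))) \<inter> space M =
       (Y (Suc n) -` A \<inter> space M) \<inter> ((\<lambda>\<omega>. (\<xi> n \<omega>, \<theta> (Suc n) \<omega>)) -` C \<inter> space M)"
      by (auto simp: coord_def space_PiM)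
    also have "?r ?B1 -` ((\<lambda>f. f (0, Suc n)) -` A \<inter> space (?P ?B1)) \<inter> space M = Y (Suc n) -` A \<inter> space M"
      by (auto simp: coord_def space_PiM)
    also have "?r ?B2 -` ((\<lambda>f. (f (1, n), f (2, Suc n))) -` C \<inter> space (?P ?B2)) \<inter> space M =
       (\<lambda>\<omega>. (\<xi> n \<omega>, \<theta> (Suc n) \<omega>)) -` C \<inter> space M"
      by (auto simp: coord_def space_PiM)
    finally show "prob ((Y (Suc n) -` A \<inter> space M) \<inter> ((\<lambda>\<omega>. (\<xi> n \<omega>, \<theta> (Suc n) \<omega>)) -` C \<inter> space M)) =
      prob (Y (Suc n) -` A \<inter> space M) * prob ((\<lambda>\<omega>. (\<xi> n \<omega>, \<theta> (Suc n) \<omega>)) -` C \<inter> space M)" .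
  qed simp_all
  also have "distr M (borel \<Otimes>\<^sub>M borel) (\<lambda>\<omega>. (\<xi> n \<omega>, \<theta> (Suc n) \<omega>)) =
    distr M borel (\<xi> n) \<Otimes>\<^sub>M distr M borel (\<theta> (Suc n))"
  proof -
    have "indep_var borel ((\<lambda>f. f (1, n)) \<circ> ?r {(1, n)}) borel ((\<lambda>f. f (2, Suc n)) \<circ> ?r {(2, Suc n)})"
      by (rule indep_var_compose[OF indep])
        (auto intro!: measurable_component_singleton simp: B_def)
    then have "indep_var borel (\<xi> n) borel (\<theta> (Suc n))"
      by (simp add: o_def coord_def)
    then show ?thesis by (simp add: indep_var_distribution_eq)
  qed
  also have "distr M borel (Y (Suc n)) = \<nu>"
    by (rule distr_Y) simp
  also have "distr M borel (\<xi> n) = unit_uniform"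
    using distributed_distr_eq_density[OF distributed_\<xi>[OF assms]]
    by (simp cong: distr_cong)
  also have "distr M borel (\<theta> (Suc n)) = pareto \<alpha>"
    using distributed_distr_eq_density[OF distributed_\<theta>[of "Suc n"]]
    by (simp add: pareto_def cong: distr_cong)
  finally show ?thesis .
qed

lemma AE_walk_nonneg: "AE \<omega> in M. walk n \<omega> \<ge> 0"
proof (induction n)
  case 0
  then show ?case by (simp add: walk_def)
next
  case (Suc n)
  have "AE y in distr M borel (Y (Suc n)). 0 \<le> y"
    using AE_\<nu>_nonneg by (subst distr_Y) auto
  then have Y: "AE \<omega> in M. 0 \<le> Y (Suc n) \<omega>"
    using measurable_inputs(1)[of "Suc n"] by (subst (asm) AE_distr_iff) auto
  have "AE t in distr M lborel (\<theta> (Suc n)). 1 \<le> t"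
  proof -
    have "distr M lborel (\<theta> (Suc n)) = pareto \<alpha>"
      unfolding pareto_def by (rule distributed_distr_eq_density[OF distributed_\<theta>]) simp
    then show ?thesis by (subst \<open>distr M lborel (\<theta> (Suc n)) = pareto \<alpha>\<close>) (rule AE_pareto_ge_1)
  qed
  then have \<theta>: "AE \<omega> in M. 1 \<le> \<theta> (Suc n) \<omega>"
    using measurable_inputs(3)[of "Suc n"] by (subst (asm) AE_distr_iff) auto
  show ?case
  proof (cases "n = 0")
    case True
    show ?thesis using Y AE_space[of M] by eventually_elim (simp add: walk_Suc_0 True)
  next
    case False
    show ?thesis using Suc Y \<theta> AE_space[of M]
    proof eventually_elim
      case (elim \<omega>)
      then show ?case using False
        by (simp add: walk_Suc kendall_step_def Let_def)
    qed
  qed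
qed

section \<open>The Markov property and the barrier expectations\<close>

lemma integrable_test:
  assumes "A \<in> sets M"
  shows "integrable M (\<lambda>\<omega>. indicator A \<omega> * kendall_test \<alpha> x c (walk n \<omega>))"
proof (rule integrable_const_bound[of _ "1 + \<bar>c\<bar> * x powr \<alpha>"])
  show "AE \<omega> in M. norm (indicator A \<omega> * kendall_test \<alpha> x c (walk n \<omega>)) \<le> 1 + \<bar>c\<bar> * x powr \<alpha>"
    using kendall_test_bounded[OF \<alpha>_pos] by (auto simp: indicator_def)
qed (use assms in measurable)

text \<open>
  The Markov property for one step: on an event of the past, the test function of the next position
  may be replaced by its image under the transition operator.
\<close>

lemma expectation_step:
  assumes "A \<in> sets (history n)" "x > 0"
  shows "(LINT \<omega>|M. indicator A \<omega> * kendall_test \<alpha> x c (walk (Suc n) \<omega>)) =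
    kendall_G \<alpha> \<nu> x * (LINT \<omega>|M. indicator A \<omega> * kendall_test \<alpha> x c (walk n \<omega>)) +
    kendall_H \<alpha> \<nu> x / x powr \<alpha> * (1 - c * x powr \<alpha>) *
      (LINT \<omega>|M. indicator A \<omega> * kendall_test \<alpha> x (1 / x powr \<alpha>) (walk n \<omega>))"
    (is "?L = ?R")
proof (cases "n = 0")
  case True
  \<comment> \<open>The past of time 0 consists of no coordinates, so its \<open>\<sigma>\<close>-algebra is trivial.\<close>
  have "A = {} \<or> A = space M"
  proof -
    have "past 0 = {}" by (auto simp: past_def)
    then have "sets (history 0) = {(\<lambda>\<omega>. \<lambda>p\<in>{}. coord p \<omega>) -` B \<inter> space M |B. B \<in> sets (PiM {} (\<lambda>_. borel))}"
      unfolding history_def by (subst sets_vimage_algebra2) (auto simp: space_PiM)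
    then show ?thesis using assms(1) True by (auto simp: sets_PiM_empty)
  qed
  then show ?thesis
  proof
    assume "A = {}" then show ?thesis by simp
  next
    assume A: "A = space M"
    have "?L = (LINT \<omega>|M. kendall_test \<alpha> x c (Y 1 \<omega>))"
      by (intro Bochner_Integration.integral_cong) (auto simp: A True walk_Suc_0)
    also have "\<dots> = (LINT y|distr M borel (Y 1). kendall_test \<alpha> x c y)"
      using measurable_inputs(1)[of 1] by (subst integral_distr) auto
    also have "\<dots> = kendall_G \<alpha> \<nu> x + kendall_H \<alpha> \<nu> x / x powr \<alpha> * (1 - c * x powr \<alpha>)"
      using integral_first_step[OF assms(2)] distr_Y[of 1] by simp
    also have "\<dots> = ?R"
      using assms(2) by (simp add: True walk_def kendall_test_def A prob_space)
    finally show ?thesis .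
  qed
next
  case False
  interpret H: prob_space "distr M (history n) (\<lambda>\<omega>. \<omega>)"
    by (rule prob_space_distr[OF measurable_ident_history])
  interpret P: prob_space "pareto \<alpha>" by (rule prob_space_pareto[OF \<alpha>_pos])
  interpret U: prob_space unit_uniform by (rule prob_space_unit_uniform)
  interpret UP: pair_prob_space unit_uniform "pareto \<alpha>" ..
  interpret NUP: pair_prob_space \<nu> "unit_uniform \<Otimes>\<^sub>M pareto \<alpha>" ..
  have [measurable]: "walk n \<in> borel_measurable (history n)" "A \<in> sets (history n)" "A \<in> sets M"
    using assms(1) measurable_walk_history sets_history_subset by auto
  have [measurable]: "Y (Suc n) \<in> borel_measurable M" "\<xi> n \<in> borel_measurable M" "\<theta> (Suc n) \<in> borel_measurable M"
    using measurable_inputs False by auto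
  note measurable_ident_history [measurable]
  define B where "B = 1 + \<bar>c\<bar> * x powr \<alpha>"
  define g where "g \<omega> = (\<lambda>(y, s, t). indicator A \<omega> * kendall_test \<alpha> x c (kendall_step \<alpha> (walk n \<omega>) y s t))" for \<omega>
  have bound: "\<bar>g \<omega> z\<bar> \<le> B" for \<omega> z
    using kendall_test_bounded[OF \<alpha>_pos, of x c] by (auto simp: g_def B_def indicator_def split: prod.split)
  have gm: "(\<lambda>(\<omega>, z). g \<omega> z) \<in> borel_measurable (history n \<Otimes>\<^sub>M (borel \<Otimes>\<^sub>M (borel \<Otimes>\<^sub>M borel)))"
    unfolding g_def by measurable
  have "?L = (LINT \<omega>|M. (\<lambda>(\<omega>, z). g \<omega> z) (\<omega>, Y (Suc n) \<omega>, \<xi> n \<omega>, \<theta> (Suc n) \<omega>))"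
    using False by (intro Bochner_Integration.integral_cong) (auto simp: walk_Suc g_def)
  also have "\<dots> = (LINT z|(distr M (history n \<Otimes>\<^sub>M (borel \<Otimes>\<^sub>M (borel \<Otimes>\<^sub>M borel)))
      (\<lambda>\<omega>. (\<omega>, Y (Suc n) \<omega>, \<xi> n \<omega>, \<theta> (Suc n) \<omega>))). (\<lambda>(\<omega>, z). g \<omega> z) z)"
    by (rule integral_distr [symmetric]) (use gm in measurable)
  also have "\<dots> = (LINT z|(distr M (history n) (\<lambda>\<omega>. \<omega>) \<Otimes>\<^sub>M (\<nu> \<Otimes>\<^sub>M (unit_uniform \<Otimes>\<^sub>M pareto \<alpha>))).
      (\<lambda>(\<omega>, z). g \<omega> z) z)"
    using False by (subst distr_history) auto
  also have "\<dots> = (LINT \<omega>|distr M (history n) (\<lambda>\<omega>. \<omega>). LINT z|(\<nu> \<Otimes>\<^sub>M (unit_uniform \<Otimes>\<^sub>M pareto \<alpha>)). g \<omega> z)"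
    using bound gm
    by (subst integral_pair_bounded[where B=B])
       (auto intro: H.prob_space_axioms NUP.prob_space_axioms cong: measurable_cong_sets sets_pair_measure_cong simp: sets_\<nu>)
  also have "\<dots> = (LINT \<omega>|distr M (history n) (\<lambda>\<omega>. \<omega>). indicator A \<omega> *
      (LINT y|\<nu>. LINT s|unit_uniform. LINT t|pareto \<alpha>. kendall_test \<alpha> x c (kendall_step \<alpha> (walk n \<omega>) y s t)))"
  proof (intro Bochner_Integration.integral_cong refl)
    fix \<omega>
    have m: "g \<omega> \<in> borel_measurable (\<nu> \<Otimes>\<^sub>M (unit_uniform \<Otimes>\<^sub>M pareto \<alpha>))"
      unfolding g_def by measurable
    have "(LINT z|(\<nu> \<Otimes>\<^sub>M (unit_uniform \<Otimes>\<^sub>M pareto \<alpha>)). g \<omega> z) =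
        (LINT y|\<nu>. LINT z|(unit_uniform \<Otimes>\<^sub>M pareto \<alpha>). g \<omega> (y, z))"
      using bound m by (intro integral_pair_bounded[where B=B] \<nu>.prob_space_axioms UP.prob_space_axioms)
    also have "\<dots> = (LINT y|\<nu>. LINT s|unit_uniform. LINT t|pareto \<alpha>. g \<omega> (y, s, t))"
    proof (intro Bochner_Integration.integral_cong refl)
      fix y
      have "(\<lambda>z. g \<omega> (y, z)) \<in> borel_measurable (unit_uniform \<Otimes>\<^sub>M pareto \<alpha>)"
        unfolding g_def prod.case by measurable
      then show "(LINT z|(unit_uniform \<Otimes>\<^sub>M pareto \<alpha>). g \<omega> (y, z)) =
          (LINT s|unit_uniform. LINT t|pareto \<alpha>. g \<omega> (y, s, t))"
        using bound by (intro integral_pair_bounded[where B=B] U.prob_space_axioms P.prob_space_axioms)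
    qed
    finally show "(LINT z|(\<nu> \<Otimes>\<^sub>M (unit_uniform \<Otimes>\<^sub>M pareto \<alpha>)). g \<omega> z) = indicator A \<omega> *
      (LINT y|\<nu>. LINT s|unit_uniform. LINT t|pareto \<alpha>. kendall_test \<alpha> x c (kendall_step \<alpha> (walk n \<omega>) y s t))"
      by (simp add: g_def)
  qed
  also have "\<dots> = (LINT \<omega>|M. indicator A \<omega> *
      (LINT y|\<nu>. LINT s|unit_uniform. LINT t|pareto \<alpha>. kendall_test \<alpha> x c (kendall_step \<alpha> (walk n \<omega>) y s t)))"
    by (rule integral_distr) measurable
  also have "\<dots> = (LINT \<omega>|M. kendall_G \<alpha> \<nu> x * (indicator A \<omega> * kendall_test \<alpha> x c (walk n \<omega>)) +
    kendall_H \<alpha> \<nu> x / x powr \<alpha> * (1 - c * x powr \<alpha>) *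
      (indicator A \<omega> * kendall_test \<alpha> x (1 / x powr \<alpha>) (walk n \<omega>)))"
  proof (rule integral_cong_AE)
    show "AE \<omega> in M. indicator A \<omega> *
      (LINT y|\<nu>. LINT s|unit_uniform. LINT t|pareto \<alpha>. kendall_test \<alpha> x c (kendall_step \<alpha> (walk n \<omega>) y s t)) =
      kendall_G \<alpha> \<nu> x * (indicator A \<omega> * kendall_test \<alpha> x c (walk n \<omega>)) +
    kendall_H \<alpha> \<nu> x / x powr \<alpha> * (1 - c * x powr \<alpha>) *
      (indicator A \<omega> * kendall_test \<alpha> x (1 / x powr \<alpha>) (walk n \<omega>))"
      using AE_walk_nonneg[of n]
      by eventually_elim (subst integral_transition[OF assms(2)], auto simp: algebra_simps)
  qed measurable
  also have "\<dots> = ?R"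
    using integrable_test[of A] by simp
  finally show ?thesis .
qed

lemma sets_history_mono:
  assumes "n \<le> m" "A \<in> sets (history n)" shows "A \<in> sets (history m)"
proof -
  have "(\<lambda>\<omega>. \<omega>) \<in> measurable (history m) (history n)"
    unfolding history_def[of n]
  proof (rule measurable_vimage_algebra2)
    show "(\<lambda>\<omega>. \<lambda>p\<in>past n. coord p \<omega>) \<in> measurable (history m) (PiM (past n) (\<lambda>_. borel))"
      using assms(1) by (intro measurable_restrict measurable_history_coord) (auto simp: past_def)
  qed auto
  from measurable_sets[OF this assms(2)] show ?thesis
    using sets.sets_into_space[OF assms(2)] by (simp add: Int_absorb2 vimage_def)
qed

text \<open>
  Powers of the triangular matrix. For \<open>c = 1 / x\<^sup>\<alpha>\<close> the factor \<open>1 - c x\<^sup>\<alpha>\<close> vanishes, so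
  the passage from the parameter \<open>c\<close> to \<open>1 / x\<^sup>\<alpha>\<close> happens at most once. Any one of the \<open>m\<close>
  steps can be this passage, and each of the other steps contributes a factor \<open>G(x)\<close>. For
  \<open>m = 0\<close> the truncated exponent \<open>m - 1\<close> is harmless because of the factor \<open>m\<close>.
\<close>

lemma expectation_steps:
  assumes "A \<in> sets (history n)" "x > 0"
  shows "(LINT \<omega>|M. indicator A \<omega> * kendall_test \<alpha> x c (walk (n + m) \<omega>)) =
    kendall_G \<alpha> \<nu> x ^ m * (LINT \<omega>|M. indicator A \<omega> * kendall_test \<alpha> x c (walk n \<omega>)) +
    kendall_G \<alpha> \<nu> x ^ (m - 1) * (real m * kendall_H \<alpha> \<nu> x / x powr \<alpha>) * (1 - c * x powr \<alpha>) *
      (LINT \<omega>|M. indicator A \<omega> * kendall_test \<alpha> x (1 / x powr \<alpha>) (walk n \<omega>))"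
proof (induction m arbitrary: c)
  case 0
  then show ?case by simp
next
  case (Suc m)
  have "A \<in> sets (history (n + m))" using sets_history_mono[OF _ assms(1)] by simp
  note step = expectation_step[OF this assms(2)]
  define E where "E c = (LINT \<omega>|M. indicator A \<omega> * kendall_test \<alpha> x c (walk n \<omega>))" for c
  define g where "g = kendall_G \<alpha> \<nu> x"
  define h where "h = kendall_H \<alpha> \<nu> x / x powr \<alpha>"
  define r where "r = 1 - c * x powr \<alpha>"
  have "(LINT \<omega>|M. indicator A \<omega> * kendall_test \<alpha> x c (walk (n + Suc m) \<omega>)) =
      g * (g ^ m * E c + g ^ (m - 1) * (real m * h) * r * E (1 / x powr \<alpha>)) +
      h * r * (g ^ m * E (1 / x powr \<alpha>))"
    using assms(2) by (simp add: step Suc.IH E_def g_def h_def r_def)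
  also have "\<dots> = g ^ Suc m * E c + g ^ (Suc m - 1) * (real (Suc m) * h) * r * E (1 / x powr \<alpha>)"
    by (cases m) (simp_all add: algebra_simps)
  finally show ?case by (simp add: E_def g_def h_def r_def)
qed

text \<open>
  The parameter \<open>c\<close> is what lets the induction run: the block from \<open>n k\<close> to \<open>n (Suc k)\<close> calls for
  the expectation at time \<open>n k\<close> both with the same \<open>c\<close> and with \<open>c = 1 / x (Suc k) powr \<alpha>\<close>. In the
  case \<open>k = 0\<close> both sides are 1, because \<open>walk 0 = 0\<close> and \<open>last_one\<close> is 0.
\<close>

lemma expectation_barriers:
  assumes n0: "n 0 = 0" and n_mono: "\<And>j. j \<in> {1..k} \<Longrightarrow> n (j - 1) \<le> n j"
    and x1: "k \<ge> 1 \<Longrightarrow> 0 < x 1" and x_mono: "\<And>j. j \<in> {1..<k} \<Longrightarrow> x j \<le> x (j + 1)"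
  shows "(LINT \<omega>|M. indicator {\<omega> \<in> space M. \<forall>j\<in>{1..k}. walk (n j) \<omega> \<le> x j} \<omega> *
      (1 - c * walk (n k) \<omega> powr \<alpha>)) =
    (\<Sum>\<epsilon>\<in>{1..k} \<rightarrow>\<^sub>E {0, 1}. kendall_summand \<alpha> \<nu> k n x \<epsilon> * (1 - c * last_one k \<epsilon> x powr \<alpha>))"
  using n_mono x1 x_mono
proof (induction k arbitrary: c)
  case 0
  then show ?case
    by (simp add: n0 walk_def last_one_def kendall_summand_def prob_space)
next
  case (Suc k)
  define A where "A k = {\<omega> \<in> space M. \<forall>j\<in>{1..k}. walk (n j) \<omega> \<le> x j}" for k
  define b where "b = x (Suc k)"
  define m where "m = n (Suc k) - n k"
  have nm: "n (Suc k) = n k + m" using Suc.prems(1)[of "Suc k"] by (simp add: m_def)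
  have n_le: "n j \<le> n k" if "j \<le> k" for j
    using that
  proof (induction rule: inc_induct)
    case (step i)
    then show ?case using Suc.prems(1)[of "Suc i"] by simp
  qed simp
  have x_le: "x j \<le> x i" if "1 \<le> j" "j \<le> i" "i \<le> Suc k" for i j
    using that(2,3)
  proof (induction i rule: dec_induct)
    case (step i)
    then show ?case using Suc.prems(3)[of i] that(1) by force
  qed auto
  have b: "b > 0" using Suc.prems(2) x_le[of 1 "Suc k"] by (simp add: b_def)
  have x_bounds: "0 \<le> x j \<and> x j \<le> x (Suc k)" if "j \<in> {1..k}" for j
    using that Suc.prems(2) x_le[of 1 j] x_le[of j "Suc k"] by auto
  have A_hist: "A k \<in> sets (history (n k))"
  proof -
    have "{\<omega> \<in> space (history (n k)). \<forall>j\<in>{1..k}. walk (n j) \<omega> \<le> x j} \<in> sets (history (n k))"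
      by (intro sets.sets_Collect_finite_All borel_measurable_le measurable_walk_history n_le) auto
    then show ?thesis by (simp add: A_def)
  qed
  \<comment> \<open>On \<open>A k\<close> the walk at time \<open>n k\<close> lies almost surely in \<open>[0, b]\<close>, so the truncation can be dropped there.\<close>
  have test: "(LINT \<omega>|M. indicator (A k) \<omega> * kendall_test \<alpha> b d (walk (n k) \<omega>)) =
      (\<Sum>\<epsilon>\<in>{1..k} \<rightarrow>\<^sub>E {0, 1}. kendall_summand \<alpha> \<nu> k n x \<epsilon> * (1 - d * last_one k \<epsilon> x powr \<alpha>))" for d
  proof -
    have [measurable]: "A k \<in> sets M" using sets_history_subset[OF A_hist] .
    have "(LINT \<omega>|M. indicator (A k) \<omega> * kendall_test \<alpha> b d (walk (n k) \<omega>)) =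
      (LINT \<omega>|M. indicator (A k) \<omega> * (1 - d * walk (n k) \<omega> powr \<alpha>))"
    proof (rule integral_cong_AE)
      show "AE \<omega> in M. indicator (A k) \<omega> * kendall_test \<alpha> b d (walk (n k) \<omega>) =
          indicator (A k) \<omega> * (1 - d * walk (n k) \<omega> powr \<alpha>)"
        using AE_walk_nonneg[of "n k"]
      proof eventually_elim
        case (elim \<omega>)
        have "walk (n k) \<omega> \<le> b" if "\<omega> \<in> A k"
        proof (cases "k = 0")
          case True
          then show ?thesis using b n0 by (simp add: walk_def)
        next
          case False
          then have "walk (n k) \<omega> \<le> x k" using that by (auto simp: A_def)
          also have "x k \<le> b" using x_le[of k "Suc k"] False by (simp add: b_def)
          finally show ?thesis .
        qed
        with elim show ?case by (auto simp: kendall_test_def indicator_def)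
      qed
    qed measurable
    also have "\<dots> = (\<Sum>\<epsilon>\<in>{1..k} \<rightarrow>\<^sub>E {0, 1}. kendall_summand \<alpha> \<nu> k n x \<epsilon> * (1 - d * last_one k \<epsilon> x powr \<alpha>))"
      unfolding A_def using Suc.prems by (intro Suc.IH) auto
    finally show ?thesis .
  qed
  have [measurable]: "A k \<in> sets M" "A (Suc k) \<in> sets M"
    using sets_history_subset[OF A_hist] by (simp_all add: A_def)
  have "(LINT \<omega>|M. indicator (A (Suc k)) \<omega> * (1 - c * walk (n (Suc k)) \<omega> powr \<alpha>)) =
     (LINT \<omega>|M. indicator (A k) \<omega> * kendall_test \<alpha> b c (walk (n k + m) \<omega>))"
  proof (rule integral_cong_AE)
    show "AE \<omega> in M. indicator (A (Suc k)) \<omega> * (1 - c * walk (n (Suc k)) \<omega> powr \<alpha>) =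
      indicator (A k) \<omega> * kendall_test \<alpha> b c (walk (n k + m) \<omega>)"
      using AE_walk_nonneg[of "n k + m"]
    proof eventually_elim
      case (elim \<omega>)
      have "\<omega> \<in> A (Suc k) \<longleftrightarrow> \<omega> \<in> A k \<and> walk (n k + m) \<omega> \<le> b"
        by (auto simp: A_def b_def nm [symmetric] le_Suc_eq)
      with elim show ?case by (auto simp: kendall_test_def indicator_def nm)
    qed
  qed measurable
  also have "\<dots> = (\<Sum>\<epsilon>\<in>{1..k} \<rightarrow>\<^sub>E {0, 1}.
      kendall_G \<alpha> \<nu> b ^ m * (kendall_summand \<alpha> \<nu> k n x \<epsilon> * (1 - c * last_one k \<epsilon> x powr \<alpha>)) +
      kendall_G \<alpha> \<nu> b ^ (m - 1) * (real m * kendall_H \<alpha> \<nu> b / b powr \<alpha>) * (1 - c * b powr \<alpha>) *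
        (kendall_summand \<alpha> \<nu> k n x \<epsilon> * (1 - 1 / b powr \<alpha> * last_one k \<epsilon> x powr \<alpha>)))"
    by (simp only: expectation_steps[OF A_hist b] test sum_distrib_left sum.distrib)
  also have "\<dots> = (\<Sum>\<epsilon>\<in>{1..k} \<rightarrow>\<^sub>E {0, 1}.
      kendall_summand \<alpha> \<nu> (Suc k) n x (\<epsilon>(Suc k := 0)) * (1 - c * last_one (Suc k) (\<epsilon>(Suc k := 0)) x powr \<alpha>) +
      kendall_summand \<alpha> \<nu> (Suc k) n x (\<epsilon>(Suc k := 1)) * (1 - c * last_one (Suc k) (\<epsilon>(Suc k := 1)) x powr \<alpha>))"
  proof (intro sum.cong refl)
    fix \<epsilon> :: "nat \<Rightarrow> nat" assume \<epsilon>: "\<epsilon> \<in> {1..k} \<rightarrow>\<^sub>E {0, 1}"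
    have new_1: "kendall_summand \<alpha> \<nu> (Suc k) n x (\<epsilon>(Suc k := 1)) =
        kendall_summand \<alpha> \<nu> k n x \<epsilon> * (1 - last_one k \<epsilon> x powr \<alpha> / b powr \<alpha>) *
        (kendall_G \<alpha> \<nu> b ^ (m - 1) * (real m * kendall_H \<alpha> \<nu> b / b powr \<alpha>))"
      unfolding b_def m_def
      by (rule kendall_summand_update_1[OF \<epsilon> \<alpha>_pos]) (use x_bounds b in \<open>auto simp: b_def\<close>)
    show "kendall_G \<alpha> \<nu> b ^ m * (kendall_summand \<alpha> \<nu> k n x \<epsilon> * (1 - c * last_one k \<epsilon> x powr \<alpha>)) +
      kendall_G \<alpha> \<nu> b ^ (m - 1) * (real m * kendall_H \<alpha> \<nu> b / b powr \<alpha>) * (1 - c * b powr \<alpha>) *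
        (kendall_summand \<alpha> \<nu> k n x \<epsilon> * (1 - 1 / b powr \<alpha> * last_one k \<epsilon> x powr \<alpha>)) =
      kendall_summand \<alpha> \<nu> (Suc k) n x (\<epsilon>(Suc k := 0)) * (1 - c * last_one (Suc k) (\<epsilon>(Suc k := 0)) x powr \<alpha>) +
      kendall_summand \<alpha> \<nu> (Suc k) n x (\<epsilon>(Suc k := 1)) * (1 - c * last_one (Suc k) (\<epsilon>(Suc k := 1)) x powr \<alpha>)"
      unfolding last_one_update_0[OF \<epsilon>] last_one_update_1[OF \<epsilon>] kendall_summand_update_0[OF \<epsilon>]
        new_1 b_def [symmetric] m_def [symmetric]
      by (simp add: mult_ac)
  qed
  also have "\<dots> = (\<Sum>\<epsilon>\<in>{1..Suc k} \<rightarrow>\<^sub>E {0, 1}.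
      kendall_summand \<alpha> \<nu> (Suc k) n x \<epsilon> * (1 - c * last_one (Suc k) \<epsilon> x powr \<alpha>))"
    by (rule sum_binary_Suc [symmetric])
  finally show ?case unfolding A_def .
qed

end

theorem theorem3p4:
  fixes M :: "'a measure" and \<alpha> :: real and \<nu> :: "real measure"
    and Y \<xi> \<theta> X :: "nat \<Rightarrow> 'a \<Rightarrow> real"
    and k :: nat and n :: "nat \<Rightarrow> nat" and x :: "nat \<Rightarrow> real"
  assumes "kendall_random_walk M \<alpha> \<nu> Y \<xi> \<theta> X"
    and "k \<ge> 1"
    and "n 0 = 0"
    and "\<And>j. j \<in> {1..k} \<Longrightarrow> n j \<ge> 1"
    and "\<And>j. j \<in> {1..k} \<Longrightarrow> n (j - 1) \<le> n j"
    and "0 < x 1"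
    and "\<And>j. j \<in> {1..<k} \<Longrightarrow> x j \<le> x (j + 1)"
  shows "measure M {\<omega> \<in> space M. \<forall>j\<in>{1..k}. X (n j) \<omega> \<le> x j} =
    (\<Sum>\<epsilon>\<in>{1..k} \<rightarrow>\<^sub>E {0, 1}. kendall_summand \<alpha> \<nu> k n x \<epsilon>)"
proof -
  interpret kendall_random_walk M \<alpha> \<nu> Y \<xi> \<theta> X by fact
  let ?A = "{\<omega> \<in> space M. \<forall>j\<in>{1..k}. walk (n j) \<omega> \<le> x j}"
  have "{\<omega> \<in> space M. \<forall>j\<in>{1..k}. X (n j) \<omega> \<le> x j} = ?A"
    using assms(4) by (fastforce simp: walk_def)
  moreover have "measure M ?A = (LINT \<omega>|M. indicator ?A \<omega> * (1 - 0 * walk (n k) \<omega> powr \<alpha>))"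
    by simp
  moreover have "\<dots> = (\<Sum>\<epsilon>\<in>{1..k} \<rightarrow>\<^sub>E {0, 1}.
      kendall_summand \<alpha> \<nu> k n x \<epsilon> * (1 - 0 * last_one k \<epsilon> x powr \<alpha>))"
    using assms by (intro expectation_barriers) auto
  ultimately show ?thesis by simp
qed

end
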